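(* Let $(X,\tau,\|\cdot\|)$ satisfy Condition C, with $X$ a complex vector space. Let $\{T(t)\}_{t\ge0}$ be a SCLE semigroup on $(X,\tau)$ with generator $(A,\mathcal D(A))$ and growth bound $\omega_0$. (a) If $\lambda\in\mathbb C$ is such that the improper $\tau$-Riemann integral $$R(\lambda)x:=\int_0^\infty e^{-\lambda t}T(t)x\,dt$$ exists for every $x\in X$, then $\lambda\in\rho(A)$ and $R(\lambda,A)=R(\lambda)$. (b) If the semigroup is of type $(M,\omega)$, then for every $\lambda\in\mathbb C$ with $\operatorname{Re}\lambda>\omega$ and every $x\in X$ the integral $$R(\lambda)x:=\int_0^\infty e^{-\lambda t}T(t)x\,dt$$ exists as an improper $\tau$-Riemann integral. Furthermore, $\lambda\in\rho(A)$. (c) If $\operatorname{Re}\lambda>\omega_0$, then $\lambda\in\rho(A)$.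
   Context: Condition C: $(X,\tau)$ is a locally convex space also equipped with a norm $\|\cdot\|$ such that (a) $(X,\tau)$ is sequentially complete; (b) $\tau$ is weaker than the norm topology; (c) both topologies have the same bounded sets; (d) $\mathcal N$ is countably convex. Here $\mathcal N$ is the set of $\tau$-continuous semi-norms $p$ with $p\le\|\cdot\|$, and $\mathcal N$ is countably convex if for every sequence $p_n\in\mathcal N$ and $\alpha_n\ge0$ with $\sum_n\alpha_n=1$ one has $\sum_n\alpha_np_n\in\mathcal N$. A SCLE semigroup is a family $\{T(t)\}_{t\ge0}$ of $\tau$-continuous linear operators with $T(0)=\mathrm{Id}$, $T(t)T(s)=T(t+s)$, such that $t\mapsto T(t)x$ is $\tau$-continuous for every $x$ (strong continuity), and such that for every $t\ge 0$ and $\tau$-continuous semi-norm $p$ there is a $\tau$-continuous semi-norm $q$ with $\sup_{s\le t}p(T(s)x)\le q(x)$ for all $x$ (local equi-continuity). Its generator is $Ax:=\lim_{t\downarrow0}\frac{T(t)x-x}{t}$ ($\tau$-limit) with domain $\mathcal D(A)$ the set of $x$ for which this limit exists. $\rho(A)$ is the set of $\lambda\in\mathbb C$ such that $\lambda-A:\mathcal D(A)\to X$ is bijective, and $R(\lambda,A)=(\lambda-A)^{-1}$. For $M\ge1$, $\omega\in\mathbb R$, the semigroup is of type $(M,\omega)$ if for every $p\in\mathcal N$ and $S\ge0$ there is $q\in\mathcal N$ with $\sup_{t\le S}e^{-\omega t}p(T(t)x)\le Mq(x)$ for all $x\in X$. The growth bound is $\omega_0:=\inf\{\omega\in\mathbb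 R:\exists M\ge1\text{ such that }\{T(t)\}\text{ is of type }(M,\omega)\}$. *)

theory Defs
  imports "HOL-Analysis.Analysis"
begin

text \<open>There is no type class of complex vector spaces in the libraries, so the scalar multiplication
  is an explicit argument, constrained by the locale predicate \<^locale>\<open>vector_space\<close>.  The carrier
  is a whole type; the locally convex topology and the norm are explicit arguments as well.\<close>

type_synonym 'a scaling = "complex \<Rightarrow> 'a \<Rightarrow> 'a"

definition seminorm :: "('a::ab_group_add) scaling \<Rightarrow> ('a \<Rightarrow> real) \<Rightarrow> bool" where
  "seminorm scl p \<longleftrightarrow>
     (\<forall>x. 0 \<le> p x) \<and>
     (\<forall>x y. p (x + y) \<le> p x + p y) \<and>
     (\<forall>c x. p (scl c x) = cmod c * p x)"

definition is_norm :: "('a::ab_group_add) scaling \<Rightarrow> ('a \<Rightarrow> real) \<Rightarrow> bool" where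
  "is_norm scl nrm \<longleftrightarrow> seminorm scl nrm \<and> (\<forall>x. nrm x = 0 \<longrightarrow> x = 0)"

text \<open>A locally convex space is a vector space whose topology is the one defined by some family of
  semi-norms.  The Hausdorff property is not demanded here: under condition C below it follows from
  the two topologies having the same bounded sets, as the closure of zero is a bounded subspace.\<close>

definition locally_convex_space :: "('a::ab_group_add) scaling \<Rightarrow> 'a topology \<Rightarrow> bool" where
  "locally_convex_space scl \<tau> \<longleftrightarrow>
     vector_space scl \<and>
     (\<exists>P. (\<forall>p\<in>P. seminorm scl p) \<and>
        (\<forall>U. openin \<tau> U \<longleftrightarrow>
           (\<forall>x\<in>U. \<exists>F \<epsilon>. finite F \<and> F \<subseteq> P \<and> \<epsilon> > 0 \<and> {y. \<forall>p\<in>F. p (y - x) < \<epsilon>} \<subseteq> U)))"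

definition sequentially_complete :: "('a::ab_group_add) topology \<Rightarrow> bool" where
  "sequentially_complete \<tau> \<longleftrightarrow>
     (\<forall>x :: nat \<Rightarrow> 'a.
        (\<forall>U. openin \<tau> U \<and> 0 \<in> U \<longrightarrow> (\<exists>N. \<forall>m\<ge>N. \<forall>n\<ge>N. x m - x n \<in> U)) \<longrightarrow>
        (\<exists>l. limitin \<tau> x l sequentially))"

definition norm_topology :: "('a::ab_group_add \<Rightarrow> real) \<Rightarrow> 'a topology" where
  "norm_topology nrm = Metric_space.mtopology UNIV (\<lambda>x y. nrm (x - y))"

definition tvs_bounded :: "('a::ab_group_add) scaling \<Rightarrow> 'a topology \<Rightarrow> 'a set \<Rightarrow> bool" where
  "tvs_bounded scl \<tau> B \<longleftrightarrow>
     (\<forall>U. openin \<tau> U \<and> 0 \<in> U \<longrightarrow> (\<exists>r>0. \<forall>c. cmod c \<ge> r \<longrightarrow> B \<subseteq> scl c ` U))"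

definition cont_seminorms :: "('a::ab_group_add) scaling \<Rightarrow> 'a topology \<Rightarrow> ('a \<Rightarrow> real) set" where
  "cont_seminorms scl \<tau> = {p. seminorm scl p \<and> continuous_map \<tau> euclideanreal p}"

text \<open>The set \<open>\<N>\<close> of continuous semi-norms dominated by the norm.\<close>

definition dominated_seminorms ::
  "('a::ab_group_add) scaling \<Rightarrow> 'a topology \<Rightarrow> ('a \<Rightarrow> real) \<Rightarrow> ('a \<Rightarrow> real) set" where
  "dominated_seminorms scl \<tau> nrm = {p \<in> cont_seminorms scl \<tau>. \<forall>x. p x \<le> nrm x}"

definition countably_convex :: "('a \<Rightarrow> real) set \<Rightarrow> bool" where
  "countably_convex N \<longleftrightarrow>
     (\<forall>(p :: nat \<Rightarrow> 'a \<Rightarrow> real) (\<alpha> :: nat \<Rightarrow> real).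
        (\<forall>n. p n \<in> N) \<and> (\<forall>n. \<alpha> n \<ge> 0) \<and> \<alpha> sums 1 \<longrightarrow> (\<lambda>x. \<Sum>n. \<alpha> n * p n x) \<in> N)"

definition condition_C ::
  "('a::ab_group_add) scaling \<Rightarrow> 'a topology \<Rightarrow> ('a \<Rightarrow> real) \<Rightarrow> bool" where
  "condition_C scl \<tau> nrm \<longleftrightarrow>
     locally_convex_space scl \<tau> \<and>
     is_norm scl nrm \<and>
     sequentially_complete \<tau> \<and>
     (\<forall>U. openin \<tau> U \<longrightarrow> openin (norm_topology nrm) U) \<and>
     (\<forall>B. tvs_bounded scl \<tau> B \<longleftrightarrow> tvs_bounded scl (norm_topology nrm) B) \<and>
     countably_convex (dominated_seminorms scl \<tau> nrm)"

text \<open>Only the values \<open>T t\<close> for \<open>t \<ge> 0\<close> are relevant.\<close>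

definition SCLE_semigroup ::
  "('a::ab_group_add) scaling \<Rightarrow> 'a topology \<Rightarrow> (real \<Rightarrow> 'a \<Rightarrow> 'a) \<Rightarrow> bool" where
  "SCLE_semigroup scl \<tau> T \<longleftrightarrow>
     (\<forall>t\<ge>0. Vector_Spaces.linear scl scl (T t) \<and> continuous_map \<tau> \<tau> (T t)) \<and>
     T 0 = id \<and>
     (\<forall>t\<ge>0. \<forall>s\<ge>0. T t \<circ> T s = T (t + s)) \<and>
     (\<forall>x. continuous_map (top_of_set {0..}) \<tau> (\<lambda>t. T t x)) \<and>
     (\<forall>t\<ge>0. \<forall>p\<in>cont_seminorms scl \<tau>. \<exists>q\<in>cont_seminorms scl \<tau>.
        \<forall>x. \<forall>s\<in>{0..t}. p (T s x) \<le> q x)"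

definition generator_lim ::
  "('a::ab_group_add) scaling \<Rightarrow> 'a topology \<Rightarrow> (real \<Rightarrow> 'a \<Rightarrow> 'a) \<Rightarrow> 'a \<Rightarrow> 'a \<Rightarrow> bool" where
  "generator_lim scl \<tau> T x y \<longleftrightarrow>
     limitin \<tau> (\<lambda>t. scl (complex_of_real (1 / t)) (T t x - x)) y (at_right 0)"

definition generator_dom ::
  "('a::ab_group_add) scaling \<Rightarrow> 'a topology \<Rightarrow> (real \<Rightarrow> 'a \<Rightarrow> 'a) \<Rightarrow> 'a set" where
  "generator_dom scl \<tau> T = {x. \<exists>y. generator_lim scl \<tau> T x y}"

definition generator ::
  "('a::ab_group_add) scaling \<Rightarrow> 'a topology \<Rightarrow> (real \<Rightarrow> 'a \<Rightarrow> 'a) \<Rightarrow> 'a \<Rightarrow> 'a" where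
  "generator scl \<tau> T x = (THE y. generator_lim scl \<tau> T x y)"

definition resolvent_set ::
  "('a::ab_group_add) scaling \<Rightarrow> 'a set \<Rightarrow> ('a \<Rightarrow> 'a) \<Rightarrow> complex set" where
  "resolvent_set scl D A = {z. bij_betw (\<lambda>x. scl z x - A x) D UNIV}"

definition resolvent ::
  "('a::ab_group_add) scaling \<Rightarrow> 'a set \<Rightarrow> ('a \<Rightarrow> 'a) \<Rightarrow> complex \<Rightarrow> 'a \<Rightarrow> 'a" where
  "resolvent scl D A z = inv_into D (\<lambda>x. scl z x - A x)"

definition of_type ::
  "('a::ab_group_add) scaling \<Rightarrow> 'a topology \<Rightarrow> ('a \<Rightarrow> real) \<Rightarrow> (real \<Rightarrow> 'a \<Rightarrow> 'a) \<Rightarrow> real \<Rightarrow> real \<Rightarrow> bool"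
  where
  "of_type scl \<tau> nrm T M \<omega> \<longleftrightarrow>
     (\<forall>p\<in>dominated_seminorms scl \<tau> nrm. \<forall>S\<ge>0. \<exists>q\<in>dominated_seminorms scl \<tau> nrm.
        \<forall>x. \<forall>t\<in>{0..S}. exp (- \<omega> * t) * p (T t x) \<le> M * q x)"

text \<open>The growth bound may be \<open>-\<infinity>\<close> (for instance for nilpotent semigroups), hence \<^typ>\<open>ereal\<close>.\<close>

definition growth_bound ::
  "('a::ab_group_add) scaling \<Rightarrow> 'a topology \<Rightarrow> ('a \<Rightarrow> real) \<Rightarrow> (real \<Rightarrow> 'a \<Rightarrow> 'a) \<Rightarrow> ereal" where
  "growth_bound scl \<tau> nrm T = (INF \<omega>\<in>{\<omega>. \<exists>M\<ge>1. of_type scl \<tau> nrm T M \<omega>}. ereal \<omega>)"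

text \<open>The Riemann integral over \<open>[a, b]\<close> with respect to \<open>\<tau>\<close>: the limit of the Riemann sums over all
  tagged divisions as the mesh (the maximal length of a subinterval) tends to zero.\<close>

definition has_riemann_integral ::
  "('a::ab_group_add) scaling \<Rightarrow> 'a topology \<Rightarrow> (real \<Rightarrow> 'a) \<Rightarrow> real \<Rightarrow> real \<Rightarrow> 'a \<Rightarrow> bool" where
  "has_riemann_integral scl \<tau> f a b I \<longleftrightarrow>
     (\<forall>U. openin \<tau> U \<and> I \<in> U \<longrightarrow>
        (\<exists>\<delta>>0. \<forall>D. D tagged_division_of {a..b} \<and> (\<forall>(t, K)\<in>D. measure lborel K < \<delta>) \<longrightarrow>
           (\<Sum>(t, K)\<in>D. scl (complex_of_real (measure lborel K)) (f t)) \<in> U))"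

definition has_improper_riemann_integral ::
  "('a::ab_group_add) scaling \<Rightarrow> 'a topology \<Rightarrow> (real \<Rightarrow> 'a) \<Rightarrow> 'a \<Rightarrow> bool" where
  "has_improper_riemann_integral scl \<tau> f I \<longleftrightarrow>
     (\<exists>J. (\<forall>b\<ge>0. has_riemann_integral scl \<tau> f 0 b (J b)) \<and> limitin \<tau> J I at_top)"

definition improper_riemann_integral ::
  "('a::ab_group_add) scaling \<Rightarrow> 'a topology \<Rightarrow> (real \<Rightarrow> 'a) \<Rightarrow> 'a" where
  "improper_riemann_integral scl \<tau> f = (THE I. has_improper_riemann_integral scl \<tau> f I)"

definition laplace_integrand ::
  "('a::ab_group_add) scaling \<Rightarrow> (real \<Rightarrow> 'a \<Rightarrow> 'a) \<Rightarrow> complex \<Rightarrow> 'a \<Rightarrow> real \<Rightarrow> 'a" where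
  "laplace_integrand scl T z x t = scl (exp (- z * complex_of_real t)) (T t x)"

end

theory Submission imports Defs begin

text \<open>Rescaling by \<open>e\<^sup>-\<^sup>\<lambda>\<^sup>t\<close> reduces everything to \<open>\<lambda> = 0\<close>.  Write \<open>J(b)\<close> for the integral of \<open>T(s)x\<close> over
  \<open>[0, b]\<close>.  Concatenating left Riemann sums gives \<open>J(b + h) = J(b) + T(b) J(h)\<close>, so the improper
  integral \<open>I\<close> satisfies \<open>T(h) I - I = - J(h)\<close>; dividing by \<open>h\<close> gives \<open>A I = - x\<close>, which is surjectivity.
  If \<open>A x = 0\<close>, then telescoping \<open>T(t)x - x\<close> over \<open>n\<close> equal steps and local equi-continuity force
  \<open>T(t)x = x\<close>, and the integral of a constant converges only if the constant is \<open>0\<close>, which is injectivity.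
  For a semigroup of type \<open>(M, \<omega>)\<close>, every \<open>q\<close> in \<open>\<N>\<close> is at most the norm, so each continuous semi-norm of
  the integrand decays exponentially and sequential completeness yields the integral.\<close>

text \<open>Two obstacles shape the proof. Part (a) supposes nothing but the existence of limits,
  with no decay of the integrand, so all identities for \<open>R(\<lambda>)\<close> must be read off
  convergent Riemann sums. Left sums with equal steps serve this purpose: linearity and the
  semigroup law turn \<open>T(b)\<close> of a left sum over \<open>[0, h]\<close> into a left sum
  over \<open>[b, b + h]\<close>, and the same finite sums determine the value of the integral.
  Secondly, completeness is available for sequences only, while the Riemann limit (over all tagged
  divisions) and the limit at infinity run along larger index sets. Both are therefore found along
  one sequence, and an estimate uniform over the remaining indices carries the limit over.
  Bijectivity is split asymmetrically: \<open>R(\<lambda>)\<close> is shown to be a right inverse of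
  \<open>\<lambda> - A\<close>, and the trivial kernel then makes it the resolvent.\<close>

section \<open>Tagged divisions of a real interval\<close>

lemma tagged_division_partition:
  fixes t :: "nat \<Rightarrow> real"
  assumes "1 \<le> n" "\<And>k. k < n \<Longrightarrow> t k < t (Suc k)"
  shows "(\<lambda>k. (t k, {t k..t (Suc k)})) ` {..<n} tagged_division_of {t 0..t n} \<and> t 0 \<le> t n"
  using assms
proof (induction n rule: dec_induct)
  \<comment> \<open>The induction starts at 1: for \<open>n = 0\<close> the empty family would have
    to divide the nonempty interval \<open>{t 0..t 0}\<close>.\<close>
  case base
  then show ?case
    using tagged_division_of_self_real[of "t 0" "t 0" "t 1"]
    by (simp add: lessThan_Suc less_imp_le)
next
  case (step n)
  have IH: "(\<lambda>k. (t k, {t k..t (Suc k)})) ` {..<n} tagged_division_of {t 0..t n}" "t 0 \<le> t n"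
    using step by auto
  have tn: "t n < t (Suc n)"
    using step.prems by auto
  have "{(t n, {t n..t (Suc n)})} \<union> (\<lambda>k. (t k, {t k..t (Suc k)})) ` {..<n}
      tagged_division_of {t n..t (Suc n)} \<union> {t 0..t n}"
  proof (rule tagged_division_Un)
    show "{(t n, {t n..t (Suc n)})} tagged_division_of {t n..t (Suc n)}"
      using tn by (intro tagged_division_of_self_real) auto
  qed (use IH in auto)
  moreover have "{t n..t (Suc n)} \<union> {t 0..t n} = {t 0..t (Suc n)}"
    using tn IH(2) by auto
  ultimately show ?case
    using tn IH(2) by (simp add: lessThan_Suc)
qed

text \<open>Both sides are integrals of the indicator function of \<open>K\<close> over
  \<open>[a, b]\<close>, the left one split along the division \<open>E\<close>. This is what lets
  Riemann sums over two unrelated divisions be compared.\<close>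

lemma sum_tagged_division_inter:
  fixes a b :: real
  assumes "E tagged_division_of {a..b}" "K = {c..d}" "K \<subseteq> {a..b}"
  shows "(\<Sum>(s, L)\<in>E. measure lborel (K \<inter> L)) = measure lborel K"
proof -
  have meas: "integral L (indicator K :: real \<Rightarrow> real) = measure lborel (K \<inter> L)"
    if "L = {u..v}" for L u v
  proof -
    have "K \<inter> L \<in> lmeasurable"
      using assms(2) that by simp
    then show ?thesis
      using assms(2) that by (simp add: integral_indicator)
  qed
  have int: "(indicator K :: real \<Rightarrow> real) integrable_on cbox a b"
    using assms(2) integrable_on_indicator[of K "cbox a b"] by auto
  have "integral (cbox a b) (indicator K :: real \<Rightarrow> real) = (\<Sum>(s, L)\<in>E. integral L (indicator K))"
    using assms(1) by (intro integral_combine_tagged_division_topdown[OF int]) auto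
  also have "\<dots> = (\<Sum>(s, L)\<in>E. measure lborel (K \<inter> L))"
  proof (rule sum.cong, safe)
    fix s L assume "(s, L) \<in> E"
    then obtain u v where "L = cbox u v"
      using assms(1) tagged_division_ofD(4) by blast
    then show "integral L (indicator K :: real \<Rightarrow> real) = measure lborel (K \<inter> L)"
      by (intro meas) auto
  qed
  finally show ?thesis
    using meas[of "{a..b}" a b] assms(3) by (simp add: Int_absorb2)
qed

text \<open>A common point would lie within less than \<delta> of both tags, which are at least
  \<open>2 * \<delta>\<close> apart.\<close>

lemma measure_lborel_inter_eq_0:
  fixes s t :: real
  assumes "t \<in> {a..b}" "s \<in> {c..d}" "measure lborel {a..b} < \<delta>" "measure lborel {c..d} < \<delta>"
    "2 * \<delta> \<le> \<bar>t - s\<bar>"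
  shows "measure lborel ({a..b} \<inter> {c..d}) = 0"
proof -
  have "{a..b} \<inter> {c..d} = {}"
    using assms by (auto simp: content_real_if split: if_splits)
  then show ?thesis by simp
qed

lemma fine_tagged_division_exists:
  fixes a b \<delta> :: real
  assumes "\<delta> > 0"
  shows "\<exists>D. D tagged_division_of {a..b} \<and> (\<forall>(t, K)\<in>D. measure lborel K < \<delta>)"
proof -
  \<comment> \<open>Radius \<open>\<delta> / 3\<close> confines each interval to a ball of diameter
    \<open>2 * \<delta> / 3\<close>, which leaves room for the strict bound.\<close>
  have "gauge (\<lambda>x::real. ball x (\<delta> / 3))"
    using assms by (simp add: gauge_def)
  then obtain D where D: "D tagged_division_of {a..b}" "(\<lambda>x. ball x (\<delta> / 3)) fine D"
    by (rule fine_division_exists_real[of _ a b])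
  have "measure lborel K < \<delta>" if tK: "(t, K) \<in> D" for t K
  proof -
    obtain c d where K: "K = {c..d}"
      using tagged_division_ofD(4)[OF D(1) tK] by auto
    have "K \<subseteq> ball t (\<delta> / 3)" "t \<in> K"
      using D(2) tK tagged_division_ofD(2)[OF D(1) tK] by (auto simp: fine_def)
    then have "c \<le> d" "c \<in> ball t (\<delta> / 3)" "d \<in> ball t (\<delta> / 3)"
      using subsetD[of "{c..d}" "ball t (\<delta> / 3)" c] subsetD[of "{c..d}" "ball t (\<delta> / 3)" d]
      unfolding K by auto
    then have "d - c < \<delta>" "c \<le> d"
      using assms unfolding mem_ball dist_real_def by linarith+
    then show ?thesis
      by (simp add: K)
  qed
  with D(1) show ?thesis by blast
qed

lemma sum_lessThan_add:
  "sum g {..<m + n} = sum g {..<m} + (\<Sum>k<n. g (m + k))" for g :: "nat \<Rightarrow> 'a::comm_monoid_add"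
  by (induction n) (auto simp: add.assoc)

section \<open>Semi-norms and the open sets of a locally convex space\<close>

lemma seminorm_nonneg: "seminorm scl p \<Longrightarrow> 0 \<le> p x"
  and seminorm_triangle: "seminorm scl p \<Longrightarrow> p (x + y) \<le> p x + p y"
  and seminorm_scale: "seminorm scl p \<Longrightarrow> p (scl c x) = cmod c * p x"
  by (auto simp: seminorm_def)

context
  fixes scl :: "complex \<Rightarrow> 'a::ab_group_add \<Rightarrow> 'a" and p :: "'a \<Rightarrow> real"
  assumes vs: "vector_space scl" and p: "seminorm scl p"
begin

interpretation vector_space scl by (fact vs)

lemma seminorm_zero: "p 0 = 0"
  using seminorm_scale[OF p, of 0 0] by simp

lemma seminorm_uminus: "p (- x) = p x"
  using seminorm_scale[OF p, of "-1" x] by simp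

lemma seminorm_minus_commute: "p (x - y) = p (y - x)"
  using seminorm_uminus[of "x - y"] by simp

lemma seminorm_diff_triangle: "p (x - z) \<le> p (x - y) + p (y - z)"
  using seminorm_triangle[OF p, of "x - y" "y - z"] by simp

lemma seminorm_abs_diff: "\<bar>p x - p y\<bar> \<le> p (x - y)"
  using seminorm_triangle[OF p, of "x - y" y] seminorm_triangle[OF p, of "y - x" x]
    seminorm_minus_commute[of x y] by simp

lemma seminorm_sum: "p (\<Sum>i\<in>I. f i) \<le> (\<Sum>i\<in>I. p (f i))"
proof (induction I rule: infinite_finite_induct)
  case (insert i I)
  then show ?case
    using seminorm_triangle[OF p, of "f i" "sum f I"] by simp
qed (auto simp: seminorm_zero)

end

text \<open>The generating family \<open>P\<close> is known only to exist, and its basic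
  neighbourhoods involve finitely many members. A finite sum of members is a continuous semi-norm
  that dominates each summand, so one continuous semi-norm suffices; conversely a continuous
  semi-norm has open balls around 0, and these can be translated. From here on \<open>P\<close> is
  forgotten.\<close>

lemma openin_lcs_iff:
  assumes "locally_convex_space scl \<tau>"
  shows "openin \<tau> U \<longleftrightarrow> (\<forall>x\<in>U. \<exists>p\<in>cont_seminorms scl \<tau>. \<exists>\<epsilon>>0. {y. p (y - x) < \<epsilon>} \<subseteq> U)"
proof -
  have vs: "vector_space scl"
    using assms by (simp only: locally_convex_space_def)
  obtain P where P0: "\<forall>p\<in>P. seminorm scl p"
    and op0: "\<forall>U. openin \<tau> U \<longleftrightarrow>
      (\<forall>x\<in>U. \<exists>F \<epsilon>. finite F \<and> F \<subseteq> P \<and> \<epsilon> > 0 \<and> {y. \<forall>p\<in>F. p (y - x) < \<epsilon>} \<subseteq> U)"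
    using assms unfolding locally_convex_space_def by (elim conjE exE) (rule that)
  note P = bspec[OF P0] and op = spec[OF op0]
  interpret vector_space scl by (fact vs)
  have UN: "topspace \<tau> = UNIV"
  proof -
    have "openin \<tau> UNIV" unfolding op by (auto intro!: exI[of _ "{}"] exI[of _ 1])
    then show ?thesis using openin_subset by blast
  qed
  have sumP: "(\<lambda>x. \<Sum>p\<in>F. p x) \<in> cont_seminorms scl \<tau>" if F: "finite F" "F \<subseteq> P" for F
  proof -
    define s where "s = (\<lambda>x. \<Sum>p\<in>F. p x)"
    have sn: "seminorm scl s"
      unfolding seminorm_def
    proof (intro conjI allI)
      fix x y c
      show "0 \<le> s x"
        unfolding s_def using F P by (intro sum_nonneg) (auto intro: seminorm_nonneg)
      show "s (x + y) \<le> s x + s y"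
        unfolding s_def sum.distrib[symmetric]
        using F P by (intro sum_mono) (auto intro: seminorm_triangle)
      show "s (scl c x) = cmod c * s x"
        unfolding s_def sum_distrib_left
        using F P by (intro sum.cong) (auto intro: seminorm_scale)
    qed
    have "openin \<tau> {x \<in> topspace \<tau>. s x \<in> V}" if V: "open V" for V
      unfolding op
    proof safe
      fix x assume "s x \<in> V"
      with V obtain e where e: "e > 0" "\<And>r. \<bar>r - s x\<bar> < e \<Longrightarrow> r \<in> V"
        by (auto simp: open_dist dist_real_def)
      \<comment> \<open>The added 1 keeps the quotient meaningful for empty \<open>F\<close> and
        makes \<open>card F * d\<close> strictly smaller than \<open>e\<close>.\<close>
      define d where "d = e / (real (card F) + 1)"
      have d: "d > 0" "real (card F) * d < e"
        using e(1) by (auto simp: d_def field_simps)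
      have "s y \<in> V" if y: "\<forall>p\<in>F. p (y - x) < d" for y
      proof (rule e(2))
        have "\<bar>s y - s x\<bar> \<le> s (y - x)"
          by (rule seminorm_abs_diff[OF vs sn])
        also have "\<dots> \<le> real (card F) * d"
          unfolding s_def using y by (intro sum_bounded_above) auto
        finally show "\<bar>s y - s x\<bar> < e" using d by simp
      qed
      then show "\<exists>F \<epsilon>. finite F \<and> F \<subseteq> P \<and> 0 < \<epsilon> \<and>
          {y. \<forall>p\<in>F. p (y - x) < \<epsilon>} \<subseteq> {x \<in> topspace \<tau>. s x \<in> V}"
        using d F UN by (intro exI[of _ F] exI[of _ d]) auto
    qed
    then have "continuous_map \<tau> euclideanreal s"
      by (auto simp: continuous_map_def)
    with sn show ?thesis by (simp add: cont_seminorms_def s_def)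
  qed
  show ?thesis
  proof
    assume U: "openin \<tau> U"
    show "\<forall>x\<in>U. \<exists>p\<in>cont_seminorms scl \<tau>. \<exists>\<epsilon>>0. {y. p (y - x) < \<epsilon>} \<subseteq> U"
    proof
      fix x assume "x \<in> U"
      with U obtain F e where F: "finite F" "F \<subseteq> P" "e > 0" "{y. \<forall>p\<in>F. p (y - x) < e} \<subseteq> U"
        unfolding op by (elim ballE exE conjE) (rule that, auto)
      have "p (y - x) < e" if "(\<Sum>p\<in>F. p (y - x)) < e" "p \<in> F" for p y
      proof -
        have "p (y - x) \<le> (\<Sum>p\<in>F. p (y - x))"
          using F that P by (intro member_le_sum) (auto intro: seminorm_nonneg)
        with that show ?thesis by simp
      qed
      with F show "\<exists>p\<in>cont_seminorms scl \<tau>. \<exists>\<epsilon>>0. {y. p (y - x) < \<epsilon>} \<subseteq> U"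
        by (intro bexI[OF _ sumP[of F]] exI[of _ e]) auto
    qed
  next
    assume U: "\<forall>x\<in>U. \<exists>p\<in>cont_seminorms scl \<tau>. \<exists>\<epsilon>>0. {y. p (y - x) < \<epsilon>} \<subseteq> U"
    show "openin \<tau> U"
      unfolding op
    proof
      fix x assume "x \<in> U"
      with U obtain p e where p: "p \<in> cont_seminorms scl \<tau>" "e > 0" "{y. p (y - x) < e} \<subseteq> U"
        by (elim ballE bexE exE conjE) (rule that, auto)
      \<comment> \<open>Openness of this set is used at 0; the neighbourhood found there is moved to
        \<open>x\<close> by substituting \<open>y - x\<close>, since the generating neighbourhoods
        are translation invariant.\<close>
      have o1: "openin \<tau> {y \<in> topspace \<tau>. p y \<in> {..<e}}"
        using p(1) by (intro openin_continuous_map_preimage[of _ euclideanreal])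
          (auto simp: cont_seminorms_def)
      have "p 0 = 0"
        using p(1) by (auto simp: cont_seminorms_def seminorm_zero[OF vs])
      then have "\<exists>F d. finite F \<and> F \<subseteq> P \<and> d > 0 \<and>
          {y. \<forall>p\<in>F. p (y - 0) < d} \<subseteq> {y \<in> topspace \<tau>. p y \<in> {..<e}}"
        using p(2) UN by (intro bspec[OF iffD1[OF op o1], of 0]) auto
      then obtain F d where F: "finite F" "F \<subseteq> P" "d > 0"
        "{y. \<forall>p\<in>F. p (y - 0) < d} \<subseteq> {y \<in> topspace \<tau>. p y \<in> {..<e}}"
        by (elim exE conjE) (rule that)
      have "{y. \<forall>p\<in>F. p (y - x) < d} \<subseteq> U"
      proof
        fix y assume "y \<in> {y. \<forall>p\<in>F. p (y - x) < d}"
        then have "p (y - x) < e"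
          using subsetD[OF F(4), of "y - x"] by simp
        then show "y \<in> U"
          using p(3) by blast
      qed
      with F(1-3) show "\<exists>F \<epsilon>. finite F \<and> F \<subseteq> P \<and> 0 < \<epsilon> \<and> {y. \<forall>p\<in>F. p (y - x) < \<epsilon>} \<subseteq> U"
        by (intro exI[of _ F] exI[of _ d] conjI)
    qed
  qed
qed

section \<open>Limits in a separated locally convex space\<close>

text \<open>The Hausdorff property appears as separation of points by semi-norms; under condition C
  it is supplied by the coincidence of the bounded sets.\<close>

locale separated_lcs = vector_space scl
  for scl :: "complex \<Rightarrow> 'a::ab_group_add \<Rightarrow> 'a" +
  fixes \<tau> :: "'a topology"
  assumes lcs: "locally_convex_space scl \<tau>"
    and separated: "(\<And>p. p \<in> cont_seminorms scl \<tau> \<Longrightarrow> p x = 0) \<Longrightarrow> x = 0"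
begin

abbreviation "Q \<equiv> cont_seminorms scl \<tau>"

lemma vector_space_scl: "vector_space scl"
  by unfold_locales

lemma Q_seminorm: "p \<in> Q \<Longrightarrow> seminorm scl p"
  by (simp add: cont_seminorms_def)

lemmas Q_nonneg = seminorm_nonneg[OF Q_seminorm]
  and Q_triangle = seminorm_triangle[OF Q_seminorm]
  and Q_scale = seminorm_scale[OF Q_seminorm]
  and Q_zero = seminorm_zero[OF vector_space_scl Q_seminorm]
  and Q_minus_commute = seminorm_minus_commute[OF vector_space_scl Q_seminorm]
  and Q_diff_triangle = seminorm_diff_triangle[OF vector_space_scl Q_seminorm]
  and Q_sum = seminorm_sum[OF vector_space_scl Q_seminorm]

lemma Q_cmult: "p \<in> Q \<Longrightarrow> 0 \<le> c \<Longrightarrow> (\<lambda>x. c * p x) \<in> Q"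
  unfolding cont_seminorms_def seminorm_def
  by (auto intro!: continuous_map_real_mult simp: algebra_simps)
    (metis distrib_left mult_left_mono)

lemmas openin_iff = openin_lcs_iff[OF lcs]

lemma topspace_UNIV: "topspace \<tau> = UNIV"
proof -
  have "(\<lambda>x. 0) \<in> Q"
    by (auto simp: cont_seminorms_def seminorm_def)
  then have "openin \<tau> UNIV"
    unfolding openin_iff by (auto intro!: bexI[of _ "\<lambda>x. 0"] exI[of _ 1])
  then show ?thesis
    using openin_subset by blast
qed

lemma openin_Q_ball:
  assumes "p \<in> Q"
  shows "openin \<tau> {y. p (y - x) < e}"
  unfolding openin_iff
proof
  fix z assume z: "z \<in> {y. p (y - x) < e}"
  have "p (y - x) < e" if "p (y - z) < e - p (z - x)" for y
    using that Q_diff_triangle[OF assms, of y x z] by simp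
  with z assms show "\<exists>q\<in>Q. \<exists>\<epsilon>>0. {y. q (y - z) < \<epsilon>} \<subseteq> {y. p (y - x) < e}"
    by (intro bexI[of _ p] exI[of _ "e - p (z - x)"]) auto
qed

text \<open>From here on limits for \<tau> become limits of real functions, so that sandwich
  arguments apply.\<close>

lemma limitin_iff:
  "limitin \<tau> u l F \<longleftrightarrow> (\<forall>p\<in>Q. ((\<lambda>n. p (u n - l)) \<longlongrightarrow> 0) F)"
proof
  assume lim: "limitin \<tau> u l F"
  show "\<forall>p\<in>Q. ((\<lambda>n. p (u n - l)) \<longlongrightarrow> 0) F"
  proof (intro ballI tendstoI)
    fix p and e :: real assume "p \<in> Q" "e > 0"
    then have "\<forall>\<^sub>F n in F. u n \<in> {y. p (y - l) < e}"
      using lim openin_Q_ball[of p l e] by (auto simp: limitin_def Q_zero)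
    then show "\<forall>\<^sub>F n in F. dist (p (u n - l)) 0 < e"
      by eventually_elim (use \<open>p \<in> Q\<close> in \<open>auto simp: Q_nonneg\<close>)
  qed
next
  assume lim: "\<forall>p\<in>Q. ((\<lambda>n. p (u n - l)) \<longlongrightarrow> 0) F"
  show "limitin \<tau> u l F"
    unfolding limitin_def topspace_UNIV
  proof (intro conjI UNIV_I allI impI, elim conjE)
    fix U assume "openin \<tau> U" "l \<in> U"
    then obtain p e where p: "p \<in> Q" "e > 0" "{y. p (y - l) < e} \<subseteq> U"
      unfolding openin_iff by (elim ballE bexE exE conjE) (rule that, auto)
    then have "\<forall>\<^sub>F n in F. p (u n - l) < e"
      using lim by (auto dest: order_tendstoD)
    then show "\<forall>\<^sub>F n in F. u n \<in> U"
      by eventually_elim (use p in auto)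
  qed
qed

text \<open>Closed semi-norm balls are \<tau>-closed. Estimates on Riemann sums thereby pass to
  integrals.\<close>

lemma limitin_seminorm_bound:
  assumes "limitin \<tau> u l F" "F \<noteq> bot" "p \<in> Q" "\<forall>\<^sub>F n in F. p (u n - c) \<le> K"
  shows "p (l - c) \<le> K"
proof (rule tendsto_lowerbound)
  show "((\<lambda>n. p (u n - l) + K) \<longlongrightarrow> K) F"
    using assms by (auto simp: limitin_iff intro!: tendsto_eq_intros)
  show "\<forall>\<^sub>F n in F. p (l - c) \<le> p (u n - l) + K"
    using assms(4)
  proof eventually_elim
    case (elim n)
    then show ?case
      using Q_diff_triangle[OF assms(3), of l c "u n"] Q_minus_commute[OF assms(3), of l "u n"]
      by simp
  qed
qed fact

lemma limitin_lcs_unique: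
  assumes "limitin \<tau> u a F" "limitin \<tau> u b F" "F \<noteq> bot"
  shows "a = b"
proof -
  have "p (a - b) = 0" if p: "p \<in> Q" for p
  proof -
    have "((\<lambda>n. p (u n - a) + p (u n - b)) \<longlongrightarrow> 0 + 0) F"
      using assms p by (intro tendsto_add) (auto simp: limitin_iff)
    moreover have "p (a - b) \<le> p (u n - a) + p (u n - b)" for n
      using Q_diff_triangle[OF p, of a b "u n"] Q_minus_commute[OF p, of a "u n"] by simp
    ultimately have "p (a - b) \<le> 0"
      using assms(3) by (intro tendsto_lowerbound[where F = F]) auto
    then show ?thesis using Q_nonneg[OF p, of "a - b"] by simp
  qed
  then show ?thesis
    using separated[of "a - b"] by simp
qed

lemma limitin_lcs_add:
  assumes "limitin \<tau> u a F" "limitin \<tau> v b F"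
  shows "limitin \<tau> (\<lambda>n. u n + v n) (a + b) F"
  unfolding limitin_iff
proof
  fix p assume p: "p \<in> Q"
  have "((\<lambda>n. p (u n - a) + p (v n - b)) \<longlongrightarrow> 0 + 0) F"
    using assms p by (intro tendsto_add) (auto simp: limitin_iff)
  moreover have "p (u n + v n - (a + b)) \<le> p (u n - a) + p (v n - b)" for n
    using Q_triangle[OF p, of "u n - a" "v n - b"] by (simp add: algebra_simps)
  ultimately show "((\<lambda>n. p (u n + v n - (a + b))) \<longlongrightarrow> 0) F"
    using tendsto_sandwich[of "\<lambda>n. 0" "\<lambda>n. p (u n + v n - (a + b))" F
        "\<lambda>n. p (u n - a) + p (v n - b)" 0] by (simp add: Q_nonneg[OF p])
qed

lemma limitin_lcs_uminus:
  assumes "limitin \<tau> u a F"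
  shows "limitin \<tau> (\<lambda>n. - u n) (- a) F"
  unfolding limitin_iff
proof
  fix p assume p: "p \<in> Q"
  have "p (- u n - - a) = p (u n - a)" for n
    using Q_minus_commute[OF p, of a "u n"] by simp
  then show "((\<lambda>n. p (- u n - - a)) \<longlongrightarrow> 0) F"
    using assms p by (simp add: limitin_iff)
qed

section \<open>Riemann sums and Riemann integrals\<close>

definition riemann_sum :: "(real \<Rightarrow> 'a) \<Rightarrow> (real \<times> real set) set \<Rightarrow> 'a" where
  "riemann_sum f D = (\<Sum>(t, K)\<in>D. scl (complex_of_real (measure lborel K)) (f t))"

definition fine_division :: "real \<Rightarrow> real \<Rightarrow> real \<Rightarrow> (real \<times> real set) set \<Rightarrow> bool" where
  "fine_division a b \<delta> D \<longleftrightarrow> D tagged_division_of {a..b} \<and> (\<forall>(t, K)\<in>D. measure lborel K < \<delta>)"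

lemma has_riemann_integral_iff:
  "has_riemann_integral scl \<tau> f a b I \<longleftrightarrow>
     (\<forall>p\<in>Q. \<forall>\<epsilon>>0. \<exists>\<delta>>0. \<forall>D. fine_division a b \<delta> D \<longrightarrow> p (riemann_sum f D - I) < \<epsilon>)"
  unfolding has_riemann_integral_def riemann_sum_def[symmetric] fine_division_def[symmetric]
proof
  assume int: "\<forall>U. openin \<tau> U \<and> I \<in> U \<longrightarrow>
    (\<exists>\<delta>>0. \<forall>D. fine_division a b \<delta> D \<longrightarrow> riemann_sum f D \<in> U)"
  show "\<forall>p\<in>Q. \<forall>\<epsilon>>0. \<exists>\<delta>>0. \<forall>D. fine_division a b \<delta> D \<longrightarrow> p (riemann_sum f D - I) < \<epsilon>"
  proof (intro ballI allI impI)
    fix p and e :: real assume "p \<in> Q" "e > 0"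
    then show "\<exists>\<delta>>0. \<forall>D. fine_division a b \<delta> D \<longrightarrow> p (riemann_sum f D - I) < e"
      using int[rule_format, of "{y. p (y - I) < e}"] openin_Q_ball[of p I e] by (simp add: Q_zero)
  qed
next
  assume int: "\<forall>p\<in>Q. \<forall>\<epsilon>>0. \<exists>\<delta>>0. \<forall>D. fine_division a b \<delta> D \<longrightarrow> p (riemann_sum f D - I) < \<epsilon>"
  show "\<forall>U. openin \<tau> U \<and> I \<in> U \<longrightarrow>
    (\<exists>\<delta>>0. \<forall>D. fine_division a b \<delta> D \<longrightarrow> riemann_sum f D \<in> U)"
  proof (intro allI impI, elim conjE)
    fix U assume "openin \<tau> U" "I \<in> U"
    then obtain p e where p: "p \<in> Q" "e > 0" "{y. p (y - I) < e} \<subseteq> U"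
      unfolding openin_iff by (elim ballE bexE exE conjE) (rule that, auto)
    obtain d where "d > 0" "\<forall>D. fine_division a b d D \<longrightarrow> p (riemann_sum f D - I) < e"
      using int[rule_format, OF p(1,2)] by blast
    with p(3) show "\<exists>\<delta>>0. \<forall>D. fine_division a b \<delta> D \<longrightarrow> riemann_sum f D \<in> U"
      by (intro exI[of _ d]) auto
  qed
qed

text \<open>Specializes the limit over tagged divisions to partitions listed by a strictly
  increasing sequence and tagged at left endpoints, a form on which the semigroup law acts
  termwise.\<close>

lemma left_riemann_sum_near:
  assumes "has_riemann_integral scl \<tau> f a b I" "p \<in> Q" "\<epsilon> > 0"
  shows "\<exists>\<delta>>0. \<forall>t n. 1 \<le> n \<and> t 0 = a \<and> t n = b \<and>
       (\<forall>k<n. t k < t (Suc k) \<and> t (Suc k) - t k < \<delta>) \<longrightarrow>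
       p ((\<Sum>k<n. scl (complex_of_real (t (Suc k) - t k)) (f (t k))) - I) < \<epsilon>"
proof -
  obtain d where d: "d > 0" "\<And>D. fine_division a b d D \<Longrightarrow> p (riemann_sum f D - I) < \<epsilon>"
    using assms(1)[unfolded has_riemann_integral_iff, THEN bspec, OF assms(2), THEN spec, THEN mp, OF assms(3)]
    by auto
  show ?thesis
  proof (intro exI[of _ d] conjI d(1) allI impI)
    fix t :: "nat \<Rightarrow> real" and n
    assume "1 \<le> n \<and> t 0 = a \<and> t n = b \<and> (\<forall>k<n. t k < t (Suc k) \<and> t (Suc k) - t k < d)"
    then have t: "1 \<le> n" "t 0 = a" "t n = b"
      "\<And>k. k < n \<Longrightarrow> t k < t (Suc k) \<and> t (Suc k) - t k < d"
      by auto
    define D where "D = (\<lambda>k. (t k, {t k..t (Suc k)})) ` {..<n}"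
    have D: "D tagged_division_of {a..b}"
      using tagged_division_partition[of n t] t by (auto simp: D_def)
    have lt: "t i < t j" if "i < j" "j < n" for i j
      using that
    proof (induction rule: strict_inc_induct)
      case (base i) with t(4)[of i] show ?case by simp
    next
      case (step i) with t(4)[of i] show ?case by simp
    qed
    \<comment> \<open>A tagged division is a set of pairs; without repetitions the sum over it is
      the sum over the indices.\<close>
    have "inj_on (\<lambda>k. (t k, {t k..t (Suc k)})) {..<n}"
    proof (rule inj_onI)
      fix i j assume "i \<in> {..<n}" "j \<in> {..<n}" "(t i, {t i..t (Suc i)}) = (t j, {t j..t (Suc j)})"
      then show "i = j"
        using lt[of i j] lt[of j i] by (cases i j rule: linorder_cases) auto
    qed
    then have "riemann_sum f D = (\<Sum>k<n. scl (complex_of_real (t (Suc k) - t k)) (f (t k)))"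
      unfolding D_def riemann_sum_def
      by (subst sum.reindex) (auto intro!: sum.cong dest!: t(4))
    moreover have "fine_division a b d D"
      using t(4) D by (force simp: D_def fine_division_def)
    ultimately show "p ((\<Sum>k<n. scl (complex_of_real (t (Suc k) - t k)) (f (t k))) - I) < \<epsilon>"
      using d(2) by metis
  qed
qed

definition left_sum :: "(real \<Rightarrow> 'a) \<Rightarrow> real \<Rightarrow> nat \<Rightarrow> 'a" where
  "left_sum f h n = (\<Sum>k<n. scl (complex_of_real (h / real n)) (f (real k * (h / real n))))"

text \<open>The partition consists of \<open>n\<close> equal steps on \<open>[0, b]\<close> followed
  by \<open>n\<close> equal steps on \<open>[b, b + h]\<close>, and its Riemann sum falls apart into
  the two left sums. Only their total is claimed to converge: the shifted function carries no
  integrability hypothesis.\<close>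

lemma left_sum_limit_concat:
  assumes int: "has_riemann_integral scl \<tau> f 0 (b + h) I" and "b > 0" "h > 0"
  shows "limitin \<tau> (\<lambda>n. left_sum f b n + left_sum (\<lambda>s. f (b + s)) h n) I sequentially"
  unfolding limitin_iff
proof (intro ballI tendstoI)
  fix p and e :: real assume p: "p \<in> Q" and e: "e > 0"
  obtain d where d: "d > 0"
    "\<forall>t n. 1 \<le> n \<and> t 0 = 0 \<and> t n = b + h \<and>
       (\<forall>k<n. t k < t (Suc k) \<and> t (Suc k) - t k < d) \<longrightarrow>
       p ((\<Sum>k<n. scl (complex_of_real (t (Suc k) - t k)) (f (t k))) - I) < e"
    using left_riemann_sum_near[OF int p e] by (elim exE conjE) (rule that)
  \<comment> \<open>\<open>(b + h) / n\<close> bounds both step lengths \<open>b / n\<close> and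
    \<open>h / n\<close>.\<close>
  have "(\<lambda>n. (b + h) / real n) \<longlonglongrightarrow> 0"
    by (rule lim_const_over_n)
  then have "\<forall>\<^sub>F n in sequentially. (b + h) / real n < d"
    using d(1) by (rule order_tendstoD)
  then show "\<forall>\<^sub>F n in sequentially. dist (p (left_sum f b n + left_sum (\<lambda>s. f (b + s)) h n - I)) 0 < e"
    using eventually_gt_at_top[of 0]
  proof eventually_elim
    case (elim n)
    \<comment> \<open>The two pieces agree at \<open>k = n\<close>, where both give
      \<open>b\<close>; so the step leaving index \<open>n\<close> already has length
      \<open>h / n\<close>.\<close>
    define t where "t k = (if k \<le> n then real k * (b / real n)
      else b + (real k - real n) * (h / real n))" for k
    have bn: "0 < b / n" "0 < h / n" "b / n < d" "h / n < d"
      using elim \<open>b > 0\<close> \<open>h > 0\<close> by (auto simp: field_simps)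
    have step1: "t (Suc k) - t k = b / n" if "k < n" for k
      using that by (simp add: t_def algebra_simps add_divide_distrib)
    have step2: "t (Suc (n + k)) - t (n + k) = h / n" for k
      using elim by (cases "k = 0") (auto simp: t_def field_simps)
    have "p ((\<Sum>k<n + n. scl (complex_of_real (t (Suc k) - t k)) (f (t k))) - I) < e"
    proof (rule d(2)[THEN spec[of _ t], THEN spec[of _ "n + n"], THEN mp], intro conjI allI impI)
      show "t (n + n) = b + h"
        using elim by (auto simp: t_def)
      fix k assume k: "k < n + n"
      have "t (Suc k) - t k = b / n \<or> t (Suc k) - t k = h / n"
        using step1[of k] step2[of "k - n"] by (cases "k < n") auto
      then show "t k < t (Suc k)" "t (Suc k) - t k < d"
        using bn by linarith+
    qed (use elim in \<open>auto simp: t_def\<close>)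
    also have "(\<Sum>k<n + n. scl (complex_of_real (t (Suc k) - t k)) (f (t k))) =
        left_sum f b n + left_sum (\<lambda>s. f (b + s)) h n"
      unfolding sum_lessThan_add left_sum_def
    proof (intro arg_cong2[of _ _ _ _ "(+)"] sum.cong refl)
      fix k assume "k \<in> {..<n}"
      then show "scl (complex_of_real (t (Suc k) - t k)) (f (t k)) =
          scl (complex_of_real (b / n)) (f (real k * (b / n)))"
        using step1[of k] by (simp add: t_def)
      have "t (n + k) = b + real k * (h / n)"
        using elim by (auto simp: t_def)
      then show "scl (complex_of_real (t (Suc (n + k)) - t (n + k))) (f (t (n + k))) =
          scl (complex_of_real (h / n)) (f (b + real k * (h / n)))"
        using step2[of k] by simp
    qed
    finally show ?case
      using Q_nonneg[OF p] by simp
  qed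
qed

lemma left_sum_limit:
  assumes int: "has_riemann_integral scl \<tau> f 0 b I" and "b > 0"
  shows "limitin \<tau> (left_sum f b) I sequentially"
  unfolding limitin_iff
proof (intro ballI tendstoI)
  fix p and e :: real assume p: "p \<in> Q" and e: "e > 0"
  obtain d where d: "d > 0"
    "\<forall>t n. 1 \<le> n \<and> t 0 = 0 \<and> t n = b \<and>
       (\<forall>k<n. t k < t (Suc k) \<and> t (Suc k) - t k < d) \<longrightarrow>
       p ((\<Sum>k<n. scl (complex_of_real (t (Suc k) - t k)) (f (t k))) - I) < e"
    using left_riemann_sum_near[OF int p e] by (elim exE conjE) (rule that)
  have "(\<lambda>n. b / real n) \<longlonglongrightarrow> 0"
    by (rule lim_const_over_n)
  then have "\<forall>\<^sub>F n in sequentially. b / real n < d"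
    using d(1) by (rule order_tendstoD)
  then show "\<forall>\<^sub>F n in sequentially. dist (p (left_sum f b n - I)) 0 < e"
    using eventually_gt_at_top[of 0]
  proof eventually_elim
    case (elim n)
    have step: "real (Suc k) * (b / n) - real k * (b / n) = b / n" for k
      by (simp add: algebra_simps add_divide_distrib)
    have pos: "0 < b / n"
      using elim \<open>b > 0\<close> by simp
    have "p ((\<Sum>k<n. scl (complex_of_real (real (Suc k) * (b / n) - real k * (b / n)))
        (f (real k * (b / n)))) - I) < e"
    proof (rule d(2)[THEN spec[of _ "\<lambda>k. real k * (b / n)"], THEN spec[of _ n], THEN mp],
        intro conjI allI impI)
      show "real k * (b / n) < real (Suc k) * (b / n)"
        "real (Suc k) * (b / n) - real k * (b / n) < d" for k
        using step[of k] pos elim by linarith+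
    qed (use elim in auto)
    then show ?case
      using Q_nonneg[OF p] unfolding step left_sum_def by simp
  qed
qed

text \<open>The weights \<open>h / n\<close> add up to \<open>h\<close>, so \<open>h\<close> times
  \<open>c\<close> is itself the left sum of the constant \<open>c\<close>. Applied with
  \<open>c = x\<close> for the derivative of the integral at 0 and with \<open>c = 0\<close> to
  bound tails.\<close>

lemma seminorm_left_sum_diff_le:
  assumes "p \<in> Q" "h \<ge> 0" "\<And>s. 0 \<le> s \<Longrightarrow> s \<le> h \<Longrightarrow> p (f s - c) \<le> K" "n > 0"
  shows "p (left_sum f h n - scl (complex_of_real h) c) \<le> h * K"
proof -
  have "scl (complex_of_real h) c = (\<Sum>k<n. scl (complex_of_real (h / n)) c)"
    using assms(4) by (simp flip: scale_sum_left)
  then have "left_sum f h n - scl (complex_of_real h) c =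
      (\<Sum>k<n. scl (complex_of_real (h / n)) (f (real k * (h / n)) - c))"
    by (simp add: left_sum_def scale_right_diff_distrib sum_subtractf)
  also have "p \<dots> \<le> (\<Sum>k<n. p (scl (complex_of_real (h / n)) (f (real k * (h / n)) - c)))"
    by (rule Q_sum[OF assms(1)])
  also have "\<dots> \<le> (\<Sum>k<n. h / n * K)"
  proof (rule sum_mono)
    fix k assume "k \<in> {..<n}"
    then have "real k * (h / n) \<le> n * (h / n)"
      using assms(2) by (intro mult_right_mono) auto
    then have "p (f (real k * (h / n)) - c) \<le> K"
      using assms(2,4) by (intro assms(3)) auto
    then show "p (scl (complex_of_real (h / n)) (f (real k * (h / n)) - c)) \<le> h / n * K"
      using assms(2) by (auto simp: Q_scale[OF assms(1)] intro!: mult_left_mono divide_right_mono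
          simp del: times_divide_eq_left of_real_divide)
  qed
  also have "\<dots> = h * K"
    using assms(4) by simp
  finally show ?thesis .
qed

text \<open>Left sums depend on the function alone, so they identify the proper integrals over every
  \<open>[0, b]\<close> with \<open>b > 0\<close>, and the point \<open>b = 0\<close> is invisible
  at infinity.\<close>

lemma has_improper_riemann_integral_unique:
  assumes "has_improper_riemann_integral scl \<tau> f I" "has_improper_riemann_integral scl \<tau> f I'"
  shows "I = I'"
proof -
  obtain J J' where J: "\<And>b. b \<ge> 0 \<Longrightarrow> has_riemann_integral scl \<tau> f 0 b (J b)" "limitin \<tau> J I at_top"
    and J': "\<And>b. b \<ge> 0 \<Longrightarrow> has_riemann_integral scl \<tau> f 0 b (J' b)" "limitin \<tau> J' I' at_top"
    using assms by (auto simp: has_improper_riemann_integral_def)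
  have "J b = J' b" if "b > 0" for b
    using that limitin_lcs_unique[OF left_sum_limit[OF J(1)] left_sum_limit[OF J'(1)]] by simp
  then have "\<forall>\<^sub>F b in at_top. J b = J' b"
    by (rule eventually_mono[OF eventually_gt_at_top[of 0]])
  then have "limitin \<tau> J' I at_top"
    using J(2) by (rule limitin_transform_eventually)
  then show ?thesis
    using J'(2) by (rule limitin_lcs_unique) simp
qed

lemma improper_riemann_integral_eqI:
  "has_improper_riemann_integral scl \<tau> f I \<Longrightarrow> improper_riemann_integral scl \<tau> f = I"
  unfolding improper_riemann_integral_def
  by (intro the_equality has_improper_riemann_integral_unique)

text \<open>In place of a common refinement, both sums are expanded over all pairs of intervals
  \<open>K\<close>, \<open>L\<close>, weighted by the length of their overlap. Pairs whose tags are
  at least \<open>2 * \<delta>\<close> apart have weight 0, for all others \<open>unif\<close>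
  applies, and the weights add up to \<open>b\<close>.\<close>

lemma riemann_sums_close:
  assumes p: "p \<in> Q" and "b \<ge> 0"
    and unif: "\<And>s t. s \<in> {0..b} \<Longrightarrow> t \<in> {0..b} \<Longrightarrow> \<bar>t - s\<bar> < 2 * \<delta> \<Longrightarrow> p (f t - f s) \<le> \<epsilon>"
    and "fine_division 0 b \<delta> D" "fine_division 0 b \<delta> E"
  shows "p (riemann_sum f D - riemann_sum f E) \<le> b * \<epsilon>"
proof -
  have D: "D tagged_division_of {0..b}" "\<forall>(t, K)\<in>D. measure lborel K < \<delta>"
    and E: "E tagged_division_of {0..b}" "\<forall>(t, K)\<in>E. measure lborel K < \<delta>"
    using assms by (auto simp: fine_division_def)
  define m where "m K L = measure lborel (K \<inter> L)" for K L :: "real set"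
  have ivl: "\<exists>c d. K = {c..d}" "K \<subseteq> {0..b}" "t \<in> K"
    if "F tagged_division_of {0..b}" "(t, K) \<in> F" for F t K
    using tagged_division_ofD(2-4)[OF that] by auto
  have expand: "riemann_sum f F =
      (\<Sum>(t, K)\<in>F. \<Sum>(s, L)\<in>G. scl (complex_of_real (m K L)) (f t))"
    if F: "F tagged_division_of {0..b}" and G: "G tagged_division_of {0..b}" for F G
    unfolding riemann_sum_def
  proof (intro sum.cong refl, clarify)
    fix t K assume tK: "(t, K) \<in> F"
    have eq: "(\<Sum>(s, L)\<in>G. m K L) = measure lborel K"
      unfolding m_def using ivl[OF F tK] sum_tagged_division_inter[OF G] by blast
    show "scl (complex_of_real (measure lborel K)) (f t) =
        (\<Sum>(s, L)\<in>G. scl (complex_of_real (m K L)) (f t))"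
      unfolding eq[symmetric] by (simp add: case_prod_unfold scale_sum_left)
  qed
  have "riemann_sum f E =
      (\<Sum>(s, L)\<in>E. \<Sum>(t, K)\<in>D. scl (complex_of_real (m K L)) (f s))"
    unfolding expand[OF E(1) D(1)] by (simp add: m_def Int_commute)
  also have "\<dots> = (\<Sum>(t, K)\<in>D. \<Sum>(s, L)\<in>E. scl (complex_of_real (m K L)) (f s))"
    unfolding case_prod_unfold by (rule sum.swap)
  finally have "riemann_sum f D - riemann_sum f E =
      (\<Sum>(t, K)\<in>D. \<Sum>(s, L)\<in>E. scl (complex_of_real (m K L)) (f t - f s))"
    unfolding expand[OF D(1) E(1)]
    by (simp add: case_prod_unfold scale_right_diff_distrib sum_subtractf)
  also have "p \<dots> \<le> (\<Sum>(t, K)\<in>D. \<Sum>(s, L)\<in>E. p (scl (complex_of_real (m K L)) (f t - f s)))"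
    unfolding case_prod_unfold by (intro order.trans[OF Q_sum[OF p]] sum_mono Q_sum[OF p] order_refl)
  also have "\<dots> \<le> (\<Sum>(t, K)\<in>D. \<Sum>(s, L)\<in>E. m K L * \<epsilon>)"
  proof (intro sum_mono, clarify)
    fix t K assume tK: "(t, K) \<in> D"
    show "(\<Sum>(s, L)\<in>E. p (scl (complex_of_real (m K L)) (f t - f s))) \<le> (\<Sum>(s, L)\<in>E. m K L * \<epsilon>)"
    proof (intro sum_mono, clarify)
      fix s L assume sL: "(s, L) \<in> E"
      show "p (scl (complex_of_real (m K L)) (f t - f s)) \<le> m K L * \<epsilon>"
      proof (cases "\<bar>t - s\<bar> < 2 * \<delta>")
        case True
        then have "p (f t - f s) \<le> \<epsilon>"
          using ivl[OF D(1) tK] ivl[OF E(1) sL] by (intro unif) auto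
        then show ?thesis
          by (simp add: Q_scale[OF p] m_def mult_left_mono)
      next
        case False
        obtain c d c' d' where KL: "K = {c..d}" "L = {c'..d'}"
          using ivl(1)[OF D(1) tK] ivl(1)[OF E(1) sL] by blast
        have "measure lborel K < \<delta>" "measure lborel L < \<delta>"
          using D(2) E(2) tK sL by auto
        then have "m K L = 0"
          using False ivl(3)[OF D(1) tK] ivl(3)[OF E(1) sL] unfolding m_def KL
          by (intro measure_lborel_inter_eq_0[of t _ _ s _ _ \<delta>]) auto
        then show ?thesis
          by (simp add: Q_zero[OF p])
      qed
    qed
  qed
  also have "\<dots> = (\<Sum>(t, K)\<in>D. measure lborel K * \<epsilon>)"
  proof (intro sum.cong refl, clarify)
    fix t K assume tK: "(t, K) \<in> D"
    show "(\<Sum>(s, L)\<in>E. m K L * \<epsilon>) = measure lborel K * \<epsilon>"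
      using ivl[OF D(1) tK] sum_tagged_division_inter[OF E(1), of K]
      by (auto simp: m_def case_prod_unfold simp flip: sum_distrib_right)
  qed
  also have "\<dots> = b * \<epsilon>"
    using additive_content_tagged_division[of D 0 b] D(1) \<open>b \<ge> 0\<close>
    by (simp add: case_prod_unfold flip: sum_distrib_right)
  finally show ?thesis .
qed

lemma seq_completeD:
  assumes "sequentially_complete \<tau>"
    and cauchy: "\<And>p \<epsilon>. p \<in> Q \<Longrightarrow> \<epsilon> > 0 \<Longrightarrow> \<exists>N. \<forall>m\<ge>N. \<forall>n\<ge>N. p (x m - x n) < \<epsilon>"
  shows "\<exists>l. limitin \<tau> x l sequentially"
proof (rule assms(1)[unfolded sequentially_complete_def, THEN spec, THEN mp], intro allI impI, elim conjE)
  fix U assume "openin \<tau> U" "0 \<in> U"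
  then obtain p e where p: "p \<in> Q" "e > 0" "{y. p (y - 0) < e} \<subseteq> U"
    unfolding openin_iff by (elim ballE bexE exE conjE) (rule that, auto)
  from cauchy[OF p(1,2)] show "\<exists>N. \<forall>m\<ge>N. \<forall>n\<ge>N. x m - x n \<in> U"
    by (elim ex_forward all_forward imp_forward) (use p(3) in auto)
qed

text \<open>Sequential completeness gives limits of sequences, so \<open>I\<close> is found along
  divisions of mesh below \<open>1 / (n + 1)\<close>. Any other fine division is then compared with
  a late member of that sequence.\<close>

lemma riemann_integrable:
  assumes "sequentially_complete \<tau>" "b \<ge> 0"
    and unif: "\<And>p \<epsilon>. p \<in> Q \<Longrightarrow> \<epsilon> > 0 \<Longrightarrow>
      \<exists>\<delta>>0. \<forall>s\<in>{0..b}. \<forall>t\<in>{0..b}. \<bar>t - s\<bar> < 2 * \<delta> \<longrightarrow> p (f t - f s) \<le> \<epsilon>"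
  shows "\<exists>I. has_riemann_integral scl \<tau> f 0 b I"
proof -
  have "\<exists>D. fine_division 0 b (1 / real (Suc n)) D" for n
    unfolding fine_division_def by (rule fine_tagged_division_exists) simp
  then obtain D where D: "\<And>n. fine_division 0 b (1 / real (Suc n)) (D n)"
    by metis
  have close: "\<exists>\<delta>>0. \<forall>D E. fine_division 0 b \<delta> D \<longrightarrow> fine_division 0 b \<delta> E \<longrightarrow>
      p (riemann_sum f D - riemann_sum f E) \<le> \<epsilon> / 2" if p: "p \<in> Q" "\<epsilon> > 0" for p \<epsilon>
  proof -
    \<comment> \<open>\<open>b + 1\<close> rather than \<open>b\<close> admits the degenerate case
      \<open>b = 0\<close>. Aiming at half of \<epsilon> leaves a strict inequality after the later
      passage to the limit.\<close>
    have "\<epsilon> / (2 * (b + 1)) > 0"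
      using p assms(2) by simp
    from unif[OF p(1) this] obtain d where d: "d > 0"
      "\<And>s t. s \<in> {0..b} \<Longrightarrow> t \<in> {0..b} \<Longrightarrow> \<bar>t - s\<bar> < 2 * d \<Longrightarrow> p (f t - f s) \<le> \<epsilon> / (2 * (b + 1))"
      by blast
    have le: "b * (\<epsilon> / (2 * (b + 1))) \<le> \<epsilon> / 2"
      using p assms(2) by (simp add: field_simps)
    have "p (riemann_sum f D - riemann_sum f E) \<le> \<epsilon> / 2"
      if "fine_division 0 b d D" "fine_division 0 b d E" for D E
      by (rule order.trans[OF riemann_sums_close[OF p(1) assms(2) _ that] le]) (rule d(2))
    with d(1) show ?thesis by blast
  qed
  have small: "\<exists>N. \<forall>n\<ge>N. fine_division 0 b \<delta> (D n)" if \<delta>: "\<delta> > 0" for \<delta>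
  proof -
    obtain N where N: "1 / real (Suc N) < \<delta>"
      using \<delta> nat_approx_posE by blast
    have "fine_division 0 b \<delta> (D n)" if "n \<ge> N" for n
    proof -
      have "1 / real (Suc n) \<le> 1 / real (Suc N)"
        using that by (simp add: frac_le)
      then show ?thesis
        using D[of n] N unfolding fine_division_def by force
    qed
    then show ?thesis by blast
  qed
  have "\<exists>I. limitin \<tau> (\<lambda>n. riemann_sum f (D n)) I sequentially"
  proof (rule seq_completeD[OF assms(1)])
    fix p and \<epsilon> :: real assume p: "p \<in> Q" "\<epsilon> > 0"
    obtain d where d: "d > 0" "\<And>D E. fine_division 0 b d D \<Longrightarrow> fine_division 0 b d E \<Longrightarrow>
        p (riemann_sum f D - riemann_sum f E) \<le> \<epsilon> / 2"
      using close[OF p] by blast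
    obtain N where "\<And>n. n \<ge> N \<Longrightarrow> fine_division 0 b d (D n)"
      using small[OF d(1)] by blast
    then have "p (riemann_sum f (D m) - riemann_sum f (D n)) < \<epsilon>" if "m \<ge> N" "n \<ge> N" for m n
      using d(2)[of "D m" "D n"] that p(2) by fastforce
    then show "\<exists>N. \<forall>m\<ge>N. \<forall>n\<ge>N. p (riemann_sum f (D m) - riemann_sum f (D n)) < \<epsilon>"
      by blast
  qed
  then obtain I where I: "limitin \<tau> (\<lambda>n. riemann_sum f (D n)) I sequentially"
    by blast
  have "\<exists>\<delta>>0. \<forall>E. fine_division 0 b \<delta> E \<longrightarrow> p (riemann_sum f E - I) < \<epsilon>"
    if p: "p \<in> Q" "\<epsilon> > 0" for p \<epsilon>
  proof -
    obtain d where d: "d > 0" "\<And>D E. fine_division 0 b d D \<Longrightarrow> fine_division 0 b d E \<Longrightarrow>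
      p (riemann_sum f D - riemann_sum f E) \<le> \<epsilon> / 2"
      using close[OF p] by blast
    have "p (riemann_sum f E - I) < \<epsilon>" if E: "fine_division 0 b d E" for E
    proof -
      have "\<forall>\<^sub>F n in sequentially. p (riemann_sum f (D n) - riemann_sum f E) \<le> \<epsilon> / 2"
        using small[OF d(1)] d(2) E unfolding eventually_sequentially by blast
      then have "p (I - riemann_sum f E) \<le> \<epsilon> / 2"
        by (intro limitin_seminorm_bound[OF I _ p(1)]) auto
      then show ?thesis
        using p by (simp add: Q_minus_commute)
    qed
    with d(1) show ?thesis by blast
  qed
  then show ?thesis
    unfolding has_riemann_integral_iff by blast
qed

end

section \<open>Locally equi-continuous semigroups and their integrals\<close>

text \<open>Strong continuity is recorded as right continuity at 0, a form easily inherited by the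
  rescaled semigroup; \<open>S_uniformly_continuous\<close> recovers continuity on
  \<open>[0, b]\<close> from local equi-continuity.\<close>

locale lcs_semigroup = separated_lcs +
  fixes S :: "real \<Rightarrow> 'a \<Rightarrow> 'a"
  assumes S_linear: "t \<ge> 0 \<Longrightarrow> Vector_Spaces.linear scl scl (S t)"
    and S_zero: "S 0 x = x"
    and S_add: "t \<ge> 0 \<Longrightarrow> s \<ge> 0 \<Longrightarrow> S t (S s x) = S (t + s) x"
    and S_at_0: "limitin \<tau> (\<lambda>t. S t x) x (at_right 0)"
    and S_equicontinuous: "t \<ge> 0 \<Longrightarrow> p \<in> cont_seminorms scl \<tau> \<Longrightarrow>
      \<exists>q\<in>cont_seminorms scl \<tau>. \<forall>x. \<forall>s\<in>{0..t}. p (S s x) \<le> q x"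
begin

lemma
  assumes "t \<ge> 0"
  shows S_diff: "S t (x - y) = S t x - S t y"
    and S_sum: "S t (sum f A) = (\<Sum>a\<in>A. S t (f a))"
    and S_scale: "S t (scl c x) = scl c (S t x)"
proof -
  interpret L: Vector_Spaces.linear scl scl "S t"
    using S_linear[OF assms] .
  show "S t (x - y) = S t x - S t y" "S t (sum f A) = (\<Sum>a\<in>A. S t (f a))"
    "S t (scl c x) = scl c (S t x)"
    by (rule L.diff L.sum L.scale)+
qed

lemma limitin_S:
  assumes "t \<ge> 0" "limitin \<tau> u a F"
  shows "limitin \<tau> (\<lambda>n. S t (u n)) (S t a) F"
  unfolding limitin_iff
proof
  fix p assume p: "p \<in> Q"
  obtain q where q: "q \<in> Q" "\<And>x. p (S t x) \<le> q x"
    using S_equicontinuous[OF assms(1) p] assms(1) by auto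
  have "((\<lambda>n. q (u n - a)) \<longlongrightarrow> 0) F"
    using assms(2) q(1) by (simp add: limitin_iff)
  moreover have "p (S t (u n) - S t a) \<le> q (u n - a)" for n
    using q(2)[of "u n - a"] by (simp add: S_diff[OF assms(1)])
  ultimately show "((\<lambda>n. p (S t (u n) - S t a)) \<longlongrightarrow> 0) F"
    using tendsto_sandwich[of "\<lambda>n. 0" "\<lambda>n. p (S t (u n) - S t a)" F "\<lambda>n. q (u n - a)" 0]
    by (simp add: Q_nonneg[OF p])
qed

lemma S_near_0:
  assumes "p \<in> Q" "\<epsilon> > 0"
  obtains d where "d > 0" "\<And>h. 0 \<le> h \<Longrightarrow> h < d \<Longrightarrow> p (S h x - x) \<le> \<epsilon>"
proof -
  have "((\<lambda>t. p (S t x - x)) \<longlongrightarrow> 0) (at_right 0)"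
    using S_at_0[of x] assms(1) by (simp add: limitin_iff)
  then have "\<forall>\<^sub>F h in at_right 0. p (S h x - x) < \<epsilon>"
    using assms(2) by (rule order_tendstoD)
  then obtain d where d: "d > 0" "\<And>h. 0 < h \<Longrightarrow> h < d \<Longrightarrow> p (S h x - x) < \<epsilon>"
    unfolding eventually_at_right_field by auto
  show thesis
  proof (rule that[OF d(1)])
    fix h :: real assume "0 \<le> h" "h < d"
    then show "p (S h x - x) \<le> \<epsilon>"
      using d(2)[of h] assms by (cases "h = 0") (auto simp: S_zero Q_zero less_imp_le)
  qed
qed

text \<open>For \<open>s \<le> t\<close> the difference is \<open>S s\<close> applied to
  \<open>S (t - s) x - x\<close>, and one semi-norm \<open>q\<close> controls all \<open>S s\<close>
  with \<open>s\<close> in \<open>[0, b]\<close>, so smallness near 0 spreads over the whole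
  interval. The factor 2 matches the hypothesis of \<open>riemann_integrable\<close>.\<close>

lemma S_uniformly_continuous:
  assumes "b \<ge> 0" "p \<in> Q" "\<epsilon> > 0"
  shows "\<exists>\<delta>>0. \<forall>s\<in>{0..b}. \<forall>t\<in>{0..b}. \<bar>t - s\<bar> < 2 * \<delta> \<longrightarrow> p (S t x - S s x) \<le> \<epsilon>"
proof -
  obtain q where q: "q \<in> Q" "\<And>x s. s \<in> {0..b} \<Longrightarrow> p (S s x) \<le> q x"
    using S_equicontinuous[OF assms(1,2)] by auto
  obtain d where d: "d > 0" "\<And>h. 0 \<le> h \<Longrightarrow> h < d \<Longrightarrow> q (S h x - x) \<le> \<epsilon>"
    using S_near_0[OF q(1) assms(3)] by metis
  have le: "p (S t x - S s x) \<le> \<epsilon>" if "s \<in> {0..b}" "s \<le> t" "t - s < d" for s t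
  proof -
    have "S t x - S s x = S s (S (t - s) x - x)"
      using that by (simp add: S_diff S_add)
    also have "p \<dots> \<le> q (S (t - s) x - x)"
      using that by (intro q(2))
    also have "\<dots> \<le> \<epsilon>"
      using that by (intro d(2)) auto
    finally show ?thesis .
  qed
  have "p (S t x - S s x) \<le> \<epsilon>" if "s \<in> {0..b}" "t \<in> {0..b}" "\<bar>t - s\<bar> < d" for s t
    using that le[of s t] le[of t s] Q_minus_commute[OF assms(2), of "S t x" "S s x"]
    by (cases "s \<le> t") auto
  then show ?thesis
    using d(1) by (intro exI[of _ "d / 2"]) auto
qed

lemma left_sum_S_shift:
  assumes "b \<ge> 0" "h \<ge> 0"
  shows "left_sum (\<lambda>s. S (b + s) x) h n = S b (left_sum (\<lambda>s. S s x) h n)"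
  using assms by (simp add: left_sum_def S_sum S_scale S_add)

text \<open>One sequence of sums is given two limits: the integral over \<open>[0, b + h]\<close>
  and, after the continuous operator \<open>S b\<close> is pulled out of the second left sum, the
  right-hand side.\<close>

lemma integral_S_add:
  assumes "has_riemann_integral scl \<tau> (\<lambda>s. S s x) 0 b I" "has_riemann_integral scl \<tau> (\<lambda>s. S s x) 0 h J"
    "has_riemann_integral scl \<tau> (\<lambda>s. S s x) 0 (b + h) K" and "b > 0" "h > 0"
  shows "K = I + S b J"
proof (rule limitin_lcs_unique)
  show "limitin \<tau> (\<lambda>n. left_sum (\<lambda>s. S s x) b n + left_sum (\<lambda>s. S (b + s) x) h n) K sequentially"
    using assms by (intro left_sum_limit_concat)
  show "limitin \<tau> (\<lambda>n. left_sum (\<lambda>s. S s x) b n + left_sum (\<lambda>s. S (b + s) x) h n) (I + S b J) sequentially"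
    using assms by (simp add: left_sum_S_shift limitin_lcs_add limitin_S left_sum_limit)
qed simp

text \<open>The fundamental theorem of calculus at 0: on a short interval \<open>S s x\<close> stays
  within \<open>e / 2\<close> of \<open>x\<close>, so all left sums, and then \<open>J h\<close>,
  stay within \<open>h * (e / 2)\<close> of \<open>h\<close> times \<open>x\<close>.\<close>

lemma integral_S_near_0:
  assumes J: "\<And>b. b \<ge> 0 \<Longrightarrow> has_riemann_integral scl \<tau> (\<lambda>s. S s x) 0 b (J b)"
  shows "limitin \<tau> (\<lambda>h. scl (complex_of_real (1 / h)) (J h)) x (at_right 0)"
  unfolding limitin_iff
proof (intro ballI tendstoI)
  fix p and e :: real assume p: "p \<in> Q" and e: "e > 0"
  obtain d where d: "d > 0" "\<And>h. 0 \<le> h \<Longrightarrow> h < d \<Longrightarrow> p (S h x - x) \<le> e / 2"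
    using S_near_0[OF p half_gt_zero[OF e]] by metis
  have "p (scl (complex_of_real (1 / h)) (J h) - x) < e" if h: "0 < h" "h < d" for h
  proof -
    have "p (J h - scl (complex_of_real h) x) \<le> h * (e / 2)"
    proof (rule limitin_seminorm_bound[OF left_sum_limit[OF J] _ p])
      show "\<forall>\<^sub>F n in sequentially. p (left_sum (\<lambda>s. S s x) h n - scl (complex_of_real h) x) \<le> h * (e / 2)"
        using eventually_gt_at_top[of 0]
        by eventually_elim (use h d(2) in \<open>intro seminorm_left_sum_diff_le p; simp\<close>)
    qed (use h in auto)
    moreover have "scl (complex_of_real (1 / h)) (J h) - x =
        scl (complex_of_real (1 / h)) (J h - scl (complex_of_real h) x)"
      using h by (simp add: scale_right_diff_distrib)
    then have "p (scl (complex_of_real (1 / h)) (J h) - x) = p (J h - scl (complex_of_real h) x) / h"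
      using h by (simp only: Q_scale[OF p]) (simp add: norm_divide)
    moreover have "h * (e / 2) < e * h"
      using h e by simp
    ultimately show ?thesis
      using h by (simp only: pos_divide_less_eq)
  qed
  then show "\<forall>\<^sub>F h in at_right 0. dist (p (scl (complex_of_real (1 / h)) (J h) - x)) 0 < e"
    unfolding eventually_at_right_field using d(1) Q_nonneg[OF p] by auto
qed

lemma generator_lim_improper_integral:
  assumes "has_improper_riemann_integral scl \<tau> (\<lambda>s. S s x) I"
  shows "generator_lim scl \<tau> S I (- x)"
proof -
  obtain J where J: "\<And>b. b \<ge> 0 \<Longrightarrow> has_riemann_integral scl \<tau> (\<lambda>s. S s x) 0 b (J b)"
    "limitin \<tau> J I at_top"
    using assms by (auto simp: has_improper_riemann_integral_def)
  \<comment> \<open>Additivity is used with \<open>h\<close> as the first interval: the operator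
    \<open>S h\<close> then stays fixed while \<open>b\<close> tends to infinity, and its continuity
    gives the limit.\<close>
  have eq: "I = J h + S h I" if h: "h > 0" for h
  proof (rule limitin_lcs_unique)
    have "filterlim (\<lambda>b. h + b) at_top at_top"
      by (rule filterlim_tendsto_add_at_top[OF tendsto_const filterlim_ident])
    then show "limitin \<tau> (\<lambda>b. J (h + b)) I at_top"
      using J(2) unfolding limitin_iff by (auto intro: filterlim_compose)
    have "limitin \<tau> (\<lambda>b. J h + S h (J b)) (J h + S h I) at_top"
      using h J(2) by (intro limitin_lcs_add limitin_S) (auto simp: topspace_UNIV)
    then show "limitin \<tau> (\<lambda>b. J (h + b)) (J h + S h I) at_top"
    proof (rule limitin_transform_eventually[rotated])
      show "\<forall>\<^sub>F b in at_top. J h + S h (J b) = J (h + b)"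
        using eventually_gt_at_top[of 0]
        by eventually_elim (use h in \<open>auto intro!: integral_S_add[symmetric] J(1)\<close>)
    qed
  qed simp
  have "limitin \<tau> (\<lambda>h. - scl (complex_of_real (1 / h)) (J h)) (- x) (at_right 0)"
    by (intro limitin_lcs_uminus integral_S_near_0 J)
  then show ?thesis
    unfolding generator_lim_def
  proof (rule limitin_transform_eventually[rotated])
    show "\<forall>\<^sub>F h in at_right 0. - scl (complex_of_real (1 / h)) (J h) =
        scl (complex_of_real (1 / h)) (S h I - I)"
      using eventually_at_right_less[of 0]
    proof eventually_elim
      case (elim h)
      then have "S h I - I = - J h"
        using eq[of h] by (metis add_diff_cancel_right' diff_minus_eq_add minus_diff_eq uminus_add_conv_diff)
      then show ?case by simp
    qed
  qed
qed

text \<open>Each increment over a step \<open>h\<close> is some \<open>S (k * h)\<close> applied to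
  \<open>S h x - x\<close>, and a single \<open>q\<close> bounds all of these up to time
  \<open>t\<close>. With \<open>h = t / n\<close> the \<open>n\<close> increments contribute at most
  \<open>t\<close> times \<open>q\<close> of the difference quotient, which tends to 0.\<close>

lemma S_fixed_of_generator_lim_0:
  assumes gen: "generator_lim scl \<tau> S x 0" and "t \<ge> 0"
  shows "S t x = x"
proof (cases "t = 0")
  case False
  with \<open>t \<ge> 0\<close> have t: "t > 0" by simp
  have "p (S t x - x) = 0" if p: "p \<in> Q" for p
  proof -
    obtain q where q: "q \<in> Q" "\<And>x s. s \<in> {0..t} \<Longrightarrow> p (S s x) \<le> q x"
      using S_equicontinuous[OF assms(2) p] by auto
    have step: "p (S (real k * h) x - x) \<le> real k * q (S h x - x)"
      if h: "h \<ge> 0" "real k * h \<le> t" for h k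
      using h(2)
    proof (induction k)
      case 0
      then show ?case by (simp add: S_zero Q_zero[OF p])
    next
      case (Suc k)
      have k: "0 \<le> real k * h" "real k * h \<le> t"
        using Suc.prems h(1) by (auto simp: algebra_simps)
      have "S (real (Suc k) * h) x - S (real k * h) x = S (real k * h) (S h x - x)"
        using k h(1) by (simp add: S_diff S_add algebra_simps)
      then have "p (S (real (Suc k) * h) x - S (real k * h) x) \<le> q (S h x - x)"
        using k by (auto intro!: q(2))
      moreover have "p (S (real k * h) x - x) \<le> real k * q (S h x - x)"
        by (rule Suc.IH[OF k(2)])
      ultimately show ?case
        using Q_diff_triangle[OF p, of "S (real (Suc k) * h) x" x "S (real k * h) x"]
        by (simp add: algebra_simps)
    qed
    have "filterlim (\<lambda>n. t / real n) (at_right 0) sequentially"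
      unfolding filterlim_at using t
      by (auto intro!: lim_const_over_n eventually_mono[OF eventually_gt_at_top[of 0]])
    moreover have "((\<lambda>h. q (scl (complex_of_real (1 / h)) (S h x - x))) \<longlongrightarrow> 0) (at_right 0)"
      using gen q(1) by (simp add: generator_lim_def limitin_iff)
    ultimately have "(\<lambda>n. q (scl (complex_of_real (1 / (t / real n))) (S (t / real n) x - x))) \<longlonglongrightarrow> 0"
      by (rule filterlim_compose[rotated])
    then have lim: "(\<lambda>n. t * q (scl (complex_of_real (1 / (t / real n))) (S (t / real n) x - x))) \<longlonglongrightarrow> 0"
      by (rule tendsto_mult_right_zero)
    have "p (S t x - x) \<le> 0"
    proof (rule tendsto_lowerbound[OF lim])
      show "\<forall>\<^sub>F n in sequentially. p (S t x - x) \<le>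
          t * q (scl (complex_of_real (1 / (t / real n))) (S (t / real n) x - x))"
        using eventually_gt_at_top[of 0]
      proof eventually_elim
        case (elim n)
        then show ?case
          using step[of "t / n" n] t by (simp add: Q_scale[OF q(1)] norm_divide norm_mult)
      qed
    qed simp
    then show ?thesis
      using Q_nonneg[OF p, of "S t x - x"] by simp
  qed
  then show ?thesis
    using separated[of "S t x - x"] by simp
qed (simp add: S_zero)

text \<open>The left sums are multiples of \<open>x\<close> and so fixed by \<open>S 1\<close>;
  hence \<open>J b\<close> is fixed too, and additivity reads \<open>J (1 + b) = J 1 + J b\<close>.
  Letting \<open>b\<close> tend to infinity forces \<open>J 1 = 0\<close>, while every nonempty left
  sum over \<open>[0, 1]\<close> equals \<open>x\<close>.\<close>

lemma improper_integral_S_fixed: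
  assumes "has_improper_riemann_integral scl \<tau> (\<lambda>s. S s x) I"
    and fixed: "\<And>t. t \<ge> 0 \<Longrightarrow> S t x = x"
  shows "x = 0"
proof -
  obtain J where J: "\<And>b. b \<ge> 0 \<Longrightarrow> has_riemann_integral scl \<tau> (\<lambda>s. S s x) 0 b (J b)"
    "limitin \<tau> J I at_top"
    using assms by (auto simp: has_improper_riemann_integral_def)
  have Jb: "J (1 + b) = J 1 + J b" if b: "b > 0" for b
  proof -
    have "limitin \<tau> (\<lambda>n. S 1 (left_sum (\<lambda>s. S s x) b n)) (S 1 (J b)) sequentially"
      using b by (intro limitin_S left_sum_limit J) auto
    moreover have "S 1 (left_sum (\<lambda>s. S s x) b n) = left_sum (\<lambda>s. S s x) b n" for n
      using b by (simp add: left_sum_def S_sum S_scale fixed)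
    moreover have "limitin \<tau> (left_sum (\<lambda>s. S s x) b) (J b) sequentially"
      using b by (intro left_sum_limit J) auto
    ultimately have "S 1 (J b) = J b"
      using limitin_lcs_unique by fastforce
    then show ?thesis
      using b integral_S_add[OF J(1)[of 1] J(1)[of b] J(1)[of "1 + b"]] by simp
  qed
  have "I = J 1 + I"
  proof (rule limitin_lcs_unique)
    have "filterlim (\<lambda>b::real. 1 + b) at_top at_top"
      by (rule filterlim_tendsto_add_at_top[OF tendsto_const filterlim_ident])
    then show "limitin \<tau> (\<lambda>b. J (1 + b)) I at_top"
      using J(2) unfolding limitin_iff by (auto intro: filterlim_compose)
    have "limitin \<tau> (\<lambda>b. J 1 + J b) (J 1 + I) at_top"
      using J(2) by (intro limitin_lcs_add) (auto simp: topspace_UNIV)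
    then show "limitin \<tau> (\<lambda>b. J (1 + b)) (J 1 + I) at_top"
    proof (rule limitin_transform_eventually[rotated])
      show "\<forall>\<^sub>F b in at_top. J 1 + J b = J (1 + b)"
        using eventually_gt_at_top[of 0] by eventually_elim (simp add: Jb)
    qed
  qed simp
  then have "J 1 = 0" by simp
  have "left_sum (\<lambda>s. S s x) 1 n = x" if "n > 0" for n
    using that by (simp add: left_sum_def fixed flip: scale_sum_left)
  then have "\<forall>\<^sub>F n in sequentially. left_sum (\<lambda>s. S s x) 1 n = x"
    by (intro eventually_mono[OF eventually_gt_at_top[of 0]])
  then have "limitin \<tau> (\<lambda>n. x) (J 1) sequentially"
    using left_sum_limit[OF J(1)[of 1]] by (rule limitin_transform_eventually) auto
  moreover have "limitin \<tau> (\<lambda>n. x) x sequentially"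
    by (simp add: topspace_UNIV)
  ultimately show ?thesis
    using \<open>J 1 = 0\<close> limitin_lcs_unique by fastforce
qed

lemma generator_lim_diff:
  assumes "generator_lim scl \<tau> S x u" "generator_lim scl \<tau> S y v"
  shows "generator_lim scl \<tau> S (x - y) (u - v)"
proof -
  have "limitin \<tau> (\<lambda>t. scl (complex_of_real (1 / t)) (S t x - x) +
      - scl (complex_of_real (1 / t)) (S t y - y)) (u + - v) (at_right 0)"
    using assms unfolding generator_lim_def by (intro limitin_lcs_add limitin_lcs_uminus)
  then have "limitin \<tau> (\<lambda>t. scl (complex_of_real (1 / t)) (S t x - x) +
      - scl (complex_of_real (1 / t)) (S t y - y)) (u - v) (at_right 0)"
    by simp
  then show ?thesis
    unfolding generator_lim_def
  proof (rule limitin_transform_eventually[rotated])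
    show "\<forall>\<^sub>F t in at_right 0. scl (complex_of_real (1 / t)) (S t x - x) +
        - scl (complex_of_real (1 / t)) (S t y - y) =
        scl (complex_of_real (1 / t)) (S t (x - y) - (x - y))"
      using eventually_at_right_less[of 0]
    proof eventually_elim
      case (elim t)
      then show ?case
        by (simp add: S_diff scale_right_diff_distrib)
    qed
  qed
qed

lemma generator_eqI:
  "generator_lim scl \<tau> S x y \<Longrightarrow> generator scl \<tau> S x = y"
  unfolding generator_def generator_lim_def
  by (intro the_equality limitin_lcs_unique) auto

text \<open>\<open>J\<close> is Cauchy along the integers, where sequential completeness applies,
  and its oscillation over an interval of length at most 1 beginning at \<open>b\<close> decays like
  \<open>exp (- \<alpha> * b)\<close>, which settles the limit along the reals.\<close>

lemma improper_integral_S_exists: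
  assumes sc: "sequentially_complete \<tau>" and \<alpha>: "\<alpha> > 0"
    and bound: "\<And>p. p \<in> Q \<Longrightarrow> \<exists>C. \<forall>t\<ge>0. p (S t x) \<le> C * exp (- \<alpha> * t)"
  shows "\<exists>I. has_improper_riemann_integral scl \<tau> (\<lambda>s. S s x) I"
proof -
  have "\<exists>I. has_riemann_integral scl \<tau> (\<lambda>s. S s x) 0 b I" if "b \<ge> 0" for b
    using that by (intro riemann_integrable sc S_uniformly_continuous)
  then obtain J where J: "\<And>b. b \<ge> 0 \<Longrightarrow> has_riemann_integral scl \<tau> (\<lambda>s. S s x) 0 b (J b)"
    by metis
  define r where "r = exp (- \<alpha>)"
  have r: "0 < r" "r < 1"
    using \<alpha> by (auto simp: r_def)
  have r_pow: "exp (- \<alpha> * real n) = r ^ n" for n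
    by (simp add: r_def flip: exp_of_nat_mult)
  \<comment> \<open>The increment equals \<open>S b (J h)\<close>, a limit of left sums of the
    shifted function, which inherit the bound valid from time \<open>b\<close> onwards.\<close>
  have incr: "\<exists>C\<ge>0. \<forall>b h. b > 0 \<longrightarrow> 0 \<le> h \<longrightarrow> h \<le> 1 \<longrightarrow> p (J (b + h) - J b) \<le> C * exp (- \<alpha> * b)"
    if p: "p \<in> Q" for p
  proof -
    obtain C where C: "\<And>t. t \<ge> 0 \<Longrightarrow> p (S t x) \<le> C * exp (- \<alpha> * t)"
      using bound[OF p] by blast
    have "C \<ge> 0"
      using C[of 0] Q_nonneg[OF p, of "S 0 x"] by simp
    moreover have "p (J (b + h) - J b) \<le> C * exp (- \<alpha> * b)" if h: "b > 0" "0 \<le> h" "h \<le> 1" for b h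
    proof (cases "h = 0")
      case True
      then show ?thesis using \<open>C \<ge> 0\<close> by (simp add: Q_zero[OF p])
    next
      case False
      with h have "h > 0" by simp
      have K: "p (S (b + s) x - 0) \<le> C * exp (- \<alpha> * b)" if "s \<ge> 0" for s
      proof -
        have "C * exp (- \<alpha> * (b + s)) \<le> C * exp (- \<alpha> * b)"
          using \<open>C \<ge> 0\<close> \<alpha> that by (intro mult_left_mono) auto
        then show ?thesis
          using C[of "b + s"] h that by simp
      qed
      have "p (S b (J h) - 0) \<le> h * (C * exp (- \<alpha> * b))"
      proof (rule limitin_seminorm_bound[OF _ _ p])
        show "limitin \<tau> (\<lambda>n. S b (left_sum (\<lambda>s. S s x) h n)) (S b (J h)) sequentially"
          using h \<open>h > 0\<close> by (intro limitin_S left_sum_limit J) auto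
        show "\<forall>\<^sub>F n in sequentially. p (S b (left_sum (\<lambda>s. S s x) h n) - 0) \<le> h * (C * exp (- \<alpha> * b))"
          using eventually_gt_at_top[of 0]
        proof eventually_elim
          case (elim n)
          have "p (left_sum (\<lambda>s. S (b + s) x) h n - scl (complex_of_real h) 0) \<le> h * (C * exp (- \<alpha> * b))"
            using h elim K by (intro seminorm_left_sum_diff_le[OF p]) simp_all
          then show ?case
            using h by (simp add: left_sum_S_shift)
        qed
      qed simp
      also have "\<dots> \<le> 1 * (C * exp (- \<alpha> * b))"
        using h \<open>C \<ge> 0\<close> by (intro mult_right_mono) auto
      finally show ?thesis
        using integral_S_add[OF J[of b] J[of h] J[of "b + h"]] h \<open>h > 0\<close> by simp
    qed
    ultimately show ?thesis by blast
  qed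
  have tail: "\<exists>B\<ge>0. \<forall>n k. n > 0 \<longrightarrow> p (J (real (n + k)) - J (real n)) \<le> B * r ^ n"
    if p: "p \<in> Q" for p
  proof -
    obtain C where C: "C \<ge> 0" "\<And>b h. b > 0 \<Longrightarrow> 0 \<le> h \<Longrightarrow> h \<le> 1 \<Longrightarrow>
        p (J (b + h) - J b) \<le> C * exp (- \<alpha> * b)"
      using incr[OF p] by blast
    \<comment> \<open>The geometric series: with \<open>C = B * (1 - r)\<close> the bound for one
      step is \<open>B\<close> times a difference of consecutive powers of \<open>r\<close>, so the
      induction on \<open>k\<close> telescopes.\<close>
    define B where "B = C / (1 - r)"
    have B: "B \<ge> 0" "C = B * (1 - r)"
      using C(1) r by (auto simp: B_def)
    have "p (J (real (n + k)) - J (real n)) \<le> B * (r ^ n - r ^ (n + k))" if n: "n > 0" for n k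
    proof (induction k)
      case 0
      show ?case by (simp add: Q_zero[OF p])
    next
      case (Suc k)
      have "p (J (real (n + k) + 1) - J (real (n + k))) \<le> B * (1 - r) * r ^ (n + k)"
        using C(2)[of "real (n + k)" 1] n by (simp only: r_pow B(2))
      then have "p (J (real (n + Suc k)) - J (real (n + k))) \<le> B * (1 - r) * r ^ (n + k)"
        by (simp add: add_ac)
      then show ?case
        using Suc Q_diff_triangle[OF p, of "J (real (n + Suc k))" "J (real n)" "J (real (n + k))"]
        by (simp add: algebra_simps)
    qed
    moreover have "B * (r ^ n - r ^ (n + k)) \<le> B * r ^ n" for n k
      using B(1) r by (intro mult_left_mono) auto
    ultimately show ?thesis
      using B(1) by (meson order.trans)
  qed
  have decay: "\<exists>N. \<forall>n\<ge>N. B * r ^ n < e" if "e > 0" for B e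
  proof -
    have lim: "(\<lambda>n. B * r ^ n) \<longlonglongrightarrow> 0"
      using r by (intro tendsto_mult_right_zero LIMSEQ_power_zero) auto
    show ?thesis
      using order_tendstoD(2)[OF lim that] unfolding eventually_sequentially .
  qed
  \<comment> \<open>Sampling at \<open>Suc n\<close> keeps the lower end positive, as
    \<open>tail\<close> demands.\<close>
  have "\<exists>I. limitin \<tau> (\<lambda>n. J (real (Suc n))) I sequentially"
  proof (rule seq_completeD[OF sc])
    fix p and e :: real assume p: "p \<in> Q" "e > 0"
    obtain B where B: "\<And>n k. n > 0 \<Longrightarrow> p (J (real (n + k)) - J (real n)) \<le> B * r ^ n"
      using tail[OF p(1)] by blast
    obtain N where N: "\<And>n. n \<ge> N \<Longrightarrow> B * r ^ n < e"
      using decay[OF p(2)] by blast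
    have le: "p (J (real (Suc m)) - J (real (Suc n))) < e" if "m \<ge> n" "n \<ge> N" for m n
      using B[of "Suc n" "m - n"] N[of "Suc n"] that by (simp add: of_nat_diff)
    have "p (J (real (Suc m)) - J (real (Suc n))) < e" if "m \<ge> N" "n \<ge> N" for m n
      using le[of m n] le[of n m] that Q_minus_commute[OF p(1)] by (metis nat_le_linear)
    then show "\<exists>N. \<forall>m\<ge>N. \<forall>n\<ge>N. p (J (real (Suc m)) - J (real (Suc n))) < e"
      by blast
  qed
  then obtain I where I: "limitin \<tau> (\<lambda>n. J (real (Suc n))) I sequentially"
    by blast
  have "limitin \<tau> J I at_top"
    unfolding limitin_iff
  proof (intro ballI tendstoI)
    fix p and e :: real assume p: "p \<in> Q" and e: "e > 0"
    obtain C where C: "\<And>b h. b > 0 \<Longrightarrow> 0 \<le> h \<Longrightarrow> h \<le> 1 \<Longrightarrow>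
        p (J (b + h) - J b) \<le> C * exp (- \<alpha> * b)"
      using incr[OF p] by blast
    obtain N where N: "\<And>n. n \<ge> N \<Longrightarrow> C * r ^ n < e / 2"
      using decay[OF half_gt_zero[OF e]] by blast
    have "(\<lambda>n. p (J (real (Suc n)) - I)) \<longlonglongrightarrow> 0"
      using I p by (simp only: limitin_iff)
    then have "\<forall>\<^sub>F n in sequentially. p (J (real (Suc n)) - I) < e / 2"
      using half_gt_zero[OF e] by (rule order_tendstoD)
    then obtain N' where N': "\<And>n. n \<ge> N' \<Longrightarrow> p (J (real (Suc n)) - I) < e / 2"
      unfolding eventually_sequentially by blast
    have "p (J b - I) < e" if b: "b \<ge> real (Suc (max N N'))" for b
    proof -
      \<comment> \<open>The index is chosen so that \<open>Suc n\<close> is the integer part of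
        \<open>b\<close>.\<close>
      define n where "n = nat \<lfloor>b\<rfloor> - 1"
      have n: "real (Suc n) \<le> b" "b \<le> real (Suc n) + 1" "n \<ge> max N N'"
        using b unfolding n_def by linarith+
      have "p (J (real (Suc n) + (b - real (Suc n))) - J (real (Suc n))) \<le> C * exp (- \<alpha> * real (Suc n))"
        using n by (intro C) auto
      then have "p (J b - J (real (Suc n))) < e / 2"
        using N[of "Suc n"] n unfolding r_pow by simp
      then show ?thesis
        using Q_diff_triangle[OF p, of "J b" I "J (real (Suc n))"] N'[of n] n by simp
    qed
    then show "\<forall>\<^sub>F b in at_top. dist (p (J b - I)) 0 < e"
      using Q_nonneg[OF p] by (intro eventually_mono[OF eventually_ge_at_top[of "real (Suc (max N N'))"]]) auto
  qed
  with J show ?thesis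
    unfolding has_improper_riemann_integral_def by blast
qed

end

section \<open>Rescaling by exponentials and the resolvent\<close>

lemma tendsto_exp_scaled_at_right_0:
  "((\<lambda>t. exp (- z * complex_of_real t)) \<longlongrightarrow> 1) (at_right 0)"
proof -
  have "((\<lambda>t. exp (- z * complex_of_real t)) \<longlongrightarrow> exp (- z * complex_of_real 0)) (at_right 0)"
    by (intro tendsto_intros)
  then show ?thesis by simp
qed

text \<open>This is the derivative at 0 of \<open>exp (- z * w)\<close>, taken in the complex plane
  and restricted to positive real \<open>w\<close>.\<close>

lemma exp_scaled_difference_quotient:
  "((\<lambda>t. (exp (- z * complex_of_real t) - 1) / complex_of_real t) \<longlongrightarrow> - z) (at_right 0)"
proof -
  have "((\<lambda>w. exp (- z * w)) has_field_derivative - z) (at 0)"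
    by (auto intro!: derivative_eq_intros)
  then have "((\<lambda>w. (exp (- z * w) - 1) / w) \<longlongrightarrow> - z) (at 0)"
    by (simp add: has_field_derivative_iff)
  moreover have "filterlim complex_of_real (at 0) (at_right 0)"
    unfolding filterlim_at
    by (auto intro!: tendsto_eq_intros eventually_mono[OF eventually_at_right_less[of 0]])
  ultimately show ?thesis
    by (rule filterlim_compose)
qed

context lcs_semigroup
begin

lemma lcs_semigroup_rescaled: "lcs_semigroup scl \<tau> (\<lambda>t x. laplace_integrand scl S z x t)"
proof (intro lcs_semigroup.intro lcs_semigroup_axioms.intro)
  show "separated_lcs scl \<tau>"
    by unfold_locales
next
  fix t :: real assume t: "t \<ge> 0"
  interpret L: Vector_Spaces.linear scl scl "S t"
    using S_linear[OF t] .
  show "Vector_Spaces.linear scl scl (\<lambda>x. laplace_integrand scl S z x t)"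
    by unfold_locales
      (simp_all add: laplace_integrand_def L.add L.scale scale_right_distrib mult.commute)
next
  fix x show "laplace_integrand scl S z x 0 = x"
    by (simp add: laplace_integrand_def S_zero)
next
  fix t s :: real and x assume "t \<ge> 0" "s \<ge> 0"
  then show "laplace_integrand scl S z (laplace_integrand scl S z x s) t = laplace_integrand scl S z x (t + s)"
    by (simp add: laplace_integrand_def S_scale S_add exp_add[symmetric] algebra_simps)
next
  fix x
  show "limitin \<tau> (laplace_integrand scl S z x) x (at_right 0)"
    unfolding limitin_iff
  proof
    fix p assume p: "p \<in> Q"
    have S0: "((\<lambda>t. p (S t x - x)) \<longlongrightarrow> 0) (at_right 0)"
      using S_at_0[of x] p by (simp add: limitin_iff)
    have "((\<lambda>t. cmod (exp (- z * complex_of_real t)) * p (S t x - x) +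
        cmod (exp (- z * complex_of_real t) - 1) * p x) \<longlongrightarrow> cmod 1 * 0 + cmod (1 - 1) * p x) (at_right 0)"
      by (intro tendsto_intros tendsto_exp_scaled_at_right_0 S0)
    moreover have "p (laplace_integrand scl S z x t - x) \<le> cmod (exp (- z * complex_of_real t)) * p (S t x - x) +
        cmod (exp (- z * complex_of_real t) - 1) * p x" for t
    proof -
      have "laplace_integrand scl S z x t - x = scl (exp (- z * complex_of_real t)) (S t x - x) +
          scl (exp (- z * complex_of_real t) - 1) x"
        by (simp add: laplace_integrand_def scale_right_diff_distrib scale_left_diff_distrib)
      then show ?thesis
        using Q_triangle[OF p] by (simp only: Q_scale[OF p, symmetric])
    qed
    ultimately show "((\<lambda>t. p (laplace_integrand scl S z x t - x)) \<longlongrightarrow> 0) (at_right 0)"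
      using tendsto_sandwich[of "\<lambda>t. 0" "\<lambda>t. p (laplace_integrand scl S z x t - x)" "at_right 0"
        "\<lambda>t. cmod (exp (- z * complex_of_real t)) * p (S t x - x) +
          cmod (exp (- z * complex_of_real t) - 1) * p x" 0]
      by (simp add: Q_nonneg[OF p])
  qed
next
  fix t :: real and p assume t: "t \<ge> 0" and p: "p \<in> Q"
  obtain q where q: "q \<in> Q" "\<And>x s. s \<in> {0..t} \<Longrightarrow> p (S s x) \<le> q x"
    using S_equicontinuous[OF t p] by auto
  \<comment> \<open>On \<open>[0, t]\<close> the scalar factor has modulus at most
    \<open>exp (cmod z * t)\<close> whatever the sign of \<open>Re z\<close>, so a multiple of
    \<open>q\<close> works.\<close>
  have "p (laplace_integrand scl S z x s) \<le> exp (cmod z * t) * q x" if s: "s \<in> {0..t}" for x s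
  proof -
    have "cmod (exp (- z * complex_of_real s)) \<le> exp (cmod (- z * complex_of_real s))"
      by (rule norm_exp)
    also have "\<dots> \<le> exp (cmod z * t)"
      using s by (auto simp: norm_mult intro!: mult_left_mono)
    finally show ?thesis
      unfolding laplace_integrand_def Q_scale[OF p]
      using q(2)[OF s, of x] by (intro mult_mono) (auto simp: Q_nonneg[OF p])
  qed
  then show "\<exists>q\<in>Q. \<forall>x. \<forall>s\<in>{0..t}. p (laplace_integrand scl S z x s) \<le> q x"
    using Q_cmult[OF q(1), of "exp (cmod z * t)"] by (intro bexI[of _ "\<lambda>x. exp (cmod z * t) * q x"]) auto
qed

text \<open>The product rule: the new difference quotient is \<open>e t\<close> times the old one
  plus the difference quotient of the exponential applied to \<open>x\<close>. The middle term of
  \<open>B\<close> accounts for replacing \<open>e t\<close> by 1 in front of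
  \<open>y\<close>.\<close>

lemma generator_lim_rescaled:
  assumes "generator_lim scl \<tau> S x y"
  shows "generator_lim scl \<tau> (\<lambda>t x. laplace_integrand scl S z x t) x (y - scl z x)"
  unfolding generator_lim_def limitin_iff
proof
  fix p assume p: "p \<in> Q"
  define e where "e t = exp (- z * complex_of_real t)" for t
  define u where "u t = scl (complex_of_real (1 / t)) (S t x - x)" for t
  define v where "v t = scl (complex_of_real (1 / t)) (laplace_integrand scl S z x t - x)" for t
  define B where "B t = cmod (e t) * p (u t - y) + cmod (e t - 1) * p y +
    cmod ((e t - 1) / complex_of_real t - (- z)) * p x" for t
  have u: "((\<lambda>t. p (u t - y)) \<longlongrightarrow> 0) (at_right 0)"
    using assms p by (simp add: generator_lim_def limitin_iff u_def)
  have "(B \<longlongrightarrow> cmod 1 * 0 + cmod (1 - 1) * p y + cmod (- z - (- z)) * p x) (at_right 0)"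
    unfolding B_def e_def
    by (intro tendsto_intros tendsto_exp_scaled_at_right_0 exp_scaled_difference_quotient u)
  then have B: "(B \<longlongrightarrow> 0) (at_right 0)"
    by simp
  \<comment> \<open>The estimate is algebraic and holds for every \<open>t\<close>; at
    \<open>t = 0\<close> all quotients are 0 by convention.\<close>
  have "p (v t - (y - scl z x)) \<le> B t" for t
  proof -
    have "v t = scl (e t) (u t) + scl ((e t - 1) / complex_of_real t) x"
      by (simp add: v_def u_def e_def laplace_integrand_def scale_right_diff_distrib
          scale_left_diff_distrib diff_divide_distrib)
    then have "v t - (y - scl z x) = (scl (e t) (u t - y) + scl (e t - 1) y) +
        scl ((e t - 1) / complex_of_real t - (- z)) x"
      by (simp add: scale_right_diff_distrib scale_left_diff_distrib scale_left_distrib)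
    also have "p \<dots> \<le> B t"
      using Q_triangle[OF p, of "scl (e t) (u t - y) + scl (e t - 1) y"
          "scl ((e t - 1) / complex_of_real t - (- z)) x"]
        Q_triangle[OF p, of "scl (e t) (u t - y)" "scl (e t - 1) y"]
      unfolding B_def Q_scale[OF p] by linarith
    finally show ?thesis .
  qed
  then show "((\<lambda>t. p (scl (complex_of_real (1 / t)) (laplace_integrand scl S z x t - x) -
      (y - scl z x))) \<longlongrightarrow> 0) (at_right 0)"
    using tendsto_sandwich[OF _ _ tendsto_const B, of "\<lambda>t. p (v t - (y - scl z x))"]
    by (simp add: Q_nonneg[OF p] v_def)
qed

text \<open>The converse is the same product rule applied to the rescaled semigroup with
  \<open>- z\<close>, where the two exponential factors cancel.\<close>

lemma generator_lim_rescaled_iff: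
  "generator_lim scl \<tau> (\<lambda>t x. laplace_integrand scl S z x t) x (y - scl z x) \<longleftrightarrow> generator_lim scl \<tau> S x y"
proof
  interpret R: lcs_semigroup scl \<tau> "\<lambda>t x. laplace_integrand scl S z x t"
    by (rule lcs_semigroup_rescaled)
  have undo: "(\<lambda>t x. laplace_integrand scl (\<lambda>t x. laplace_integrand scl S z x t) (- z) x t) = S"
    by (auto simp: laplace_integrand_def fun_eq_iff simp flip: exp_add)
  assume "generator_lim scl \<tau> (\<lambda>t x. laplace_integrand scl S z x t) x (y - scl z x)"
  from R.generator_lim_rescaled[OF this, of "- z"] show "generator_lim scl \<tau> S x y"
    unfolding undo by simp
qed (rule generator_lim_rescaled)

text \<open>The fact \<open>inv\<close> serves twice: it gives surjectivity, and together with
  injectivity it identifies the preimage chosen by \<open>inv_into\<close> with the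
  integral.\<close>

lemma laplace_transform_resolvent:
  assumes int: "\<And>x. \<exists>I. has_improper_riemann_integral scl \<tau> (laplace_integrand scl S z x) I"
  defines "A \<equiv> generator scl \<tau> S" and "D \<equiv> generator_dom scl \<tau> S"
  shows "z \<in> resolvent_set scl D A"
    and "resolvent scl D A z x = improper_riemann_integral scl \<tau> (laplace_integrand scl S z x)"
proof -
  interpret R: lcs_semigroup scl \<tau> "\<lambda>t x. laplace_integrand scl S z x t"
    by (rule lcs_semigroup_rescaled)
  have A: "generator_lim scl \<tau> S x (A x)" if "x \<in> D" for x
    using that generator_eqI unfolding A_def D_def generator_dom_def by auto
  have inv: "I \<in> D" "scl z I - A I = x"
    if "has_improper_riemann_integral scl \<tau> (laplace_integrand scl S z x) I" for x I
  proof -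
    \<comment> \<open>Writing \<open>- x\<close> as \<open>(scl z I - x) - scl z I\<close> brings
      the limit for the rescaled semigroup into the form that
      \<open>generator_lim_rescaled_iff\<close> translates back.\<close>
    have "generator_lim scl \<tau> S I (scl z I - x)"
      using R.generator_lim_improper_integral[of x I] that generator_lim_rescaled_iff[of z I "scl z I - x"]
      by simp
    then show "I \<in> D" "scl z I - A I = x"
      unfolding A_def D_def generator_dom_def by (auto simp: generator_eqI)
  qed
  have inj: "inj_on (\<lambda>x. scl z x - A x) D"
  proof (rule inj_onI)
    fix x y assume xy: "x \<in> D" "y \<in> D" "scl z x - A x = scl z y - A y"
    \<comment> \<open>Equal images put \<open>x - y\<close> into the kernel of the rescaled
      generator, on which the rescaled semigroup acts as the identity.\<close>
    have "A x - scl z x - (A y - scl z y) = 0"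
      using xy(3) by (metis eq_iff_diff_eq_0 minus_diff_eq)
    then have "generator_lim scl \<tau> (\<lambda>t x. laplace_integrand scl S z x t) (x - y) 0"
      using R.generator_lim_diff[OF generator_lim_rescaled[OF A[OF xy(1)]] generator_lim_rescaled[OF A[OF xy(2)]]]
      by simp
    then have "laplace_integrand scl S z (x - y) t = x - y" if "t \<ge> 0" for t
      using that by (rule R.S_fixed_of_generator_lim_0)
    moreover obtain I where "has_improper_riemann_integral scl \<tau> (laplace_integrand scl S z (x - y)) I"
      using int by blast
    ultimately have "x - y = 0"
      by (intro R.improper_integral_S_fixed[of "x - y" I])
    then show "x = y" by simp
  qed
  moreover have "(\<lambda>x. scl z x - A x) ` D = UNIV"
    using int inv by (metis (mono_tags, lifting) UNIV_eq_I image_iff)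
  ultimately show "z \<in> resolvent_set scl D A"
    by (simp add: resolvent_set_def bij_betw_def)
  obtain I where I: "has_improper_riemann_integral scl \<tau> (laplace_integrand scl S z x) I"
    using int by blast
  have "resolvent scl D A z x = I"
    unfolding resolvent_def by (intro inv_into_f_eq inj inv[OF I])
  then show "resolvent scl D A z x = improper_riemann_integral scl \<tau> (laplace_integrand scl S z x)"
    using improper_riemann_integral_eqI[OF I] by simp
qed

text \<open>In \<open>of_type\<close> the semi-norm \<open>q\<close> may change with the time
  horizon, so it yields no decay by itself. The common bound by \<open>nrm\<close> removes this
  dependence and gives one constant for all times.\<close>

lemma laplace_integral_exists:
  assumes "sequentially_complete \<tau>" "Re z > \<omega>" "M \<ge> 1" "of_type scl \<tau> nrm S M \<omega>"
    and dominated: "\<And>p. p \<in> Q \<Longrightarrow> \<exists>c>0. \<forall>x. p x \<le> c * nrm x"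
  shows "\<exists>I. has_improper_riemann_integral scl \<tau> (laplace_integrand scl S z x) I"
proof -
  interpret R: lcs_semigroup scl \<tau> "\<lambda>t x. laplace_integrand scl S z x t"
    by (rule lcs_semigroup_rescaled)
  have "\<exists>C. \<forall>t\<ge>0. p (laplace_integrand scl S z x t) \<le> C * exp (- (Re z - \<omega>) * t)"
    if p: "p \<in> Q" for p
  proof -
    obtain c where c: "c > 0" "\<And>x. p x \<le> c * nrm x"
      using dominated[OF p] by blast
    \<comment> \<open>Division by \<open>c\<close> makes \<open>p\<close> a semi-norm to which
      \<open>of_type\<close> applies; the factor \<open>c\<close> returns in the final
      constant.\<close>
    have N: "(\<lambda>x. (1 / c) * p x) \<in> dominated_seminorms scl \<tau> nrm"
      using Q_cmult[OF p, of "1 / c"] c by (simp add: dominated_seminorms_def field_simps)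
    have "p (laplace_integrand scl S z x t) \<le> c * M * nrm x * exp (- (Re z - \<omega>) * t)" if t: "t \<ge> 0" for t
    proof -
      obtain q where q: "q \<in> dominated_seminorms scl \<tau> nrm"
        "\<And>x s. s \<in> {0..t} \<Longrightarrow> exp (- \<omega> * s) * ((1 / c) * p (S s x)) \<le> M * q x"
        using assms(4) N t unfolding of_type_def by meson
      have "exp (- \<omega> * t) * ((1 / c) * p (S t x)) \<le> M * nrm x"
      proof (rule order.trans)
        show "exp (- \<omega> * t) * ((1 / c) * p (S t x)) \<le> M * q x"
          using t by (intro q(2)) auto
        show "M * q x \<le> M * nrm x"
          using q(1) assms(3) by (intro mult_left_mono) (auto simp: dominated_seminorms_def)
      qed
      then have le: "exp (- \<omega> * t) * p (S t x) \<le> c * M * nrm x"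
        using c(1) by (simp add: field_simps)
      have "p (laplace_integrand scl S z x t) = exp (- (Re z - \<omega>) * t) * (exp (- \<omega> * t) * p (S t x))"
        by (simp add: laplace_integrand_def Q_scale[OF p] algebra_simps flip: exp_add)
      also have "\<dots> \<le> exp (- (Re z - \<omega>) * t) * (c * M * nrm x)"
        using le by (intro mult_left_mono) auto
      finally show ?thesis by (simp add: mult_ac)
    qed
    then show ?thesis by blast
  qed
  then show ?thesis
    using assms(1,2) by (intro R.improper_integral_S_exists[of "Re z - \<omega>"]) auto
qed

end

section \<open>Consequences of condition C\<close>

lemma openin_norm_topology:
  assumes "vector_space scl" "is_norm scl nrm"
  shows "openin (norm_topology nrm) U \<longleftrightarrow> (\<forall>x\<in>U. \<exists>r>0. {y. nrm (x - y) < r} \<subseteq> U)"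
proof -
  have sn: "seminorm scl nrm" and zero: "nrm x = 0 \<Longrightarrow> x = 0" for x
    using assms(2) by (auto simp: is_norm_def)
  interpret Metric_space UNIV "\<lambda>x y. nrm (x - y)"
  proof
    show "0 \<le> nrm (x - y)" for x y
      by (rule seminorm_nonneg[OF sn])
    show "nrm (x - y) = nrm (y - x)" for x y
      by (rule seminorm_minus_commute[OF assms(1) sn])
    show "(nrm (x - y) = 0) = (x = y)" for x y
      using zero[of "x - y"] seminorm_zero[OF assms(1) sn] by auto
    show "nrm (x - z) \<le> nrm (x - y) + nrm (y - z)" for x y z
      by (rule seminorm_diff_triangle[OF assms(1) sn])
  qed
  show ?thesis
    by (simp add: norm_topology_def openin_mtopology mball_def Ball_def)
qed

text \<open>The open unit ball of \<open>p\<close> is also open for the norm, so it contains a norm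
  ball of some radius \<open>r\<close>; scaling a vector to norm \<open>r / 2\<close>, inside that
  ball, yields the constant \<open>2 / r\<close>.\<close>

lemma cont_seminorm_le_norm:
  assumes "locally_convex_space scl \<tau>" "is_norm scl nrm"
    and coarser: "\<And>U. openin \<tau> U \<Longrightarrow> openin (norm_topology nrm) U"
    and p: "p \<in> cont_seminorms scl \<tau>"
  shows "\<exists>c>0. \<forall>x. p x \<le> c * nrm x"
proof -
  have vs: "vector_space scl"
    using assms(1) by (simp add: locally_convex_space_def)
  interpret vector_space scl by (rule vs)
  have sn: "seminorm scl p" "seminorm scl nrm"
    using assms by (auto simp: cont_seminorms_def is_norm_def)
  have "openin \<tau> {x \<in> topspace \<tau>. p x \<in> {..<1}}"
    using p by (intro openin_continuous_map_preimage[of _ euclideanreal]) (auto simp: cont_seminorms_def)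
  moreover have "0 \<in> topspace \<tau>"
  proof -
    have "openin \<tau> UNIV"
      unfolding openin_lcs_iff[OF assms(1)] using p by (auto intro: exI[of _ 1])
    then show ?thesis using openin_subset by blast
  qed
  ultimately have "openin (norm_topology nrm) {x \<in> topspace \<tau>. p x \<in> {..<1}}"
    "0 \<in> {x \<in> topspace \<tau>. p x \<in> {..<1}}"
    using coarser by (auto simp: seminorm_zero[OF vs sn(1)])
  then obtain r where r: "r > 0" "{y. nrm (0 - y) < r} \<subseteq> {x \<in> topspace \<tau>. p x \<in> {..<1}}"
    unfolding openin_norm_topology[OF vs assms(2)] by blast
  have "p x \<le> 2 / r * nrm x" for x
  proof (cases "nrm x = 0")
    case True
    then have "x = 0" using assms(2) by (simp add: is_norm_def)
    then show ?thesis by (simp add: seminorm_zero[OF vs] sn)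
  next
    case False
    then have pos: "nrm x > 0"
      using seminorm_nonneg[OF sn(2), of x] by simp
    define y where "y = scl (complex_of_real (r / (2 * nrm x))) x"
    have "nrm y = r / 2"
      using pos r(1) by (simp add: y_def seminorm_scale[OF sn(2)] norm_divide norm_mult del: of_real_divide)
    then have "y \<in> {y. nrm (0 - y) < r}"
      using r(1) seminorm_uminus[OF vs sn(2), of y] by simp
    then have "p y < 1"
      using r(2) by blast
    moreover have "p y = r / (2 * nrm x) * p x"
      using pos r(1) by (simp add: y_def seminorm_scale[OF sn(1)] del: of_real_divide)
    ultimately show ?thesis
      using pos r(1) by (simp add: field_simps)
  qed
  with r(1) show ?thesis by (intro exI[of _ "2 / r"]) auto
qed

text \<open>A vector annihilated by all continuous semi-norms spans a \<open>\<tau>\<close>-bounded line, and a norm-bounded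
  line is zero.\<close>

lemma cont_seminorms_separate:
  assumes "locally_convex_space scl \<tau>" "is_norm scl nrm"
    and bounded: "\<And>B. tvs_bounded scl \<tau> B \<Longrightarrow> tvs_bounded scl (norm_topology nrm) B"
    and x: "\<And>p. p \<in> cont_seminorms scl \<tau> \<Longrightarrow> p x = 0"
  shows "x = 0"
proof -
  have vs: "vector_space scl"
    using assms(1) by (simp add: locally_convex_space_def)
  interpret vector_space scl by (rule vs)
  have sn: "seminorm scl nrm"
    using assms by (auto simp: is_norm_def)
  have "tvs_bounded scl \<tau> (range (\<lambda>c. scl c x))"
    unfolding tvs_bounded_def
  proof (intro allI impI, elim conjE)
    fix U assume "openin \<tau> U" "0 \<in> U"
    then obtain p e where p: "p \<in> cont_seminorms scl \<tau>" "e > 0" "{y. p (y - 0) < e} \<subseteq> U"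
      unfolding openin_lcs_iff[OF assms(1)] by (elim ballE bexE exE conjE) (rule that, auto)
    have "p (scl d x) = 0" for d
      using p(1) x[OF p(1)] by (simp add: cont_seminorms_def seminorm_scale)
    then have U: "scl d x \<in> U" for d
      using p(2,3) by auto
    have "range (\<lambda>c. scl c x) \<subseteq> scl c ` U" if "cmod c \<ge> 1" for c
    proof safe
      fix d
      have "scl d x = scl c (scl (d / c) x)"
        using that by auto
      then show "scl d x \<in> scl c ` U"
        using U by blast
    qed
    then show "\<exists>r>0. \<forall>c. cmod c \<ge> r \<longrightarrow> range (\<lambda>c. scl c x) \<subseteq> scl c ` U"
      by (intro exI[of _ 1]) auto
  qed
  then have "tvs_bounded scl (norm_topology nrm) (range (\<lambda>c. scl c x))"
    by (rule bounded)
  moreover have "openin (norm_topology nrm) {y. nrm y < 1}"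
    unfolding openin_norm_topology[OF vs assms(2)]
  proof
    fix y assume y: "y \<in> {y. nrm y < 1}"
    have "nrm w < 1" if "nrm (y - w) < 1 - nrm y" for w
      using that seminorm_triangle[OF sn, of "w - y" y] seminorm_minus_commute[OF vs sn, of w y] by simp
    with y show "\<exists>r>0. {w. nrm (y - w) < r} \<subseteq> {y. nrm y < 1}"
      by (intro exI[of _ "1 - nrm y"]) auto
  qed
  ultimately obtain r where r: "r > 0" "\<And>c. cmod c \<ge> r \<Longrightarrow> range (\<lambda>c. scl c x) \<subseteq> scl c ` {y. nrm y < 1}"
    unfolding tvs_bounded_def by (auto simp: seminorm_zero[OF vs sn])
  have le: "nrm (scl d x) \<le> r" for d
  proof -
    have "scl d x \<in> scl (complex_of_real r) ` {y. nrm y < 1}"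
      using r by (intro subsetD[OF r(2)]) auto
    then show ?thesis
      using r(1) by (auto simp: seminorm_scale[OF sn, of "complex_of_real r"])
  qed
  have "nrm x = 0"
  proof (rule ccontr)
    assume "nrm x \<noteq> 0"
    then have "nrm x > 0"
      using seminorm_nonneg[OF sn, of x] by simp
    with le[of "complex_of_real (2 * r / nrm x)"] r(1) show False
      by (simp add: seminorm_scale[OF sn] del: of_real_divide of_real_mult)
  qed
  then show ?thesis
    using assms(2) by (simp add: is_norm_def)
qed

text \<open>Translates the punctured neighbourhood filter in which continuity of abstract topologies
  is phrased into the one from which \<open>at_right 0\<close> is reached.\<close>

lemma atin_within_euclidean: "atin_within euclidean a S = at a within S"
  by (simp add: filter_eq_iff eventually_atin_within eventually_at_topological) blast

text \<open>Separation comes from the comparison of bounded sets; right continuity at 0 comes from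
  passing to the finer filter \<open>at_right 0\<close>.\<close>

lemma condition_C_lcs_semigroup:
  assumes "condition_C scl \<tau> nrm" "SCLE_semigroup scl \<tau> T"
  shows "lcs_semigroup scl \<tau> T"
proof -
  have lc: "locally_convex_space scl \<tau>"
    using assms by (simp add: condition_C_def)
  interpret separated_lcs scl \<tau>
  proof (intro separated_lcs.intro separated_lcs_axioms.intro)
    show "vector_space scl" "locally_convex_space scl \<tau>"
      using lc by (auto simp: locally_convex_space_def)
    show "x = 0" if "\<And>p. p \<in> cont_seminorms scl \<tau> \<Longrightarrow> p x = 0" for x
      using assms(1) that
      by (intro cont_seminorms_separate[of scl \<tau> nrm x]) (auto simp: condition_C_def)
  qed
  show ?thesis
  proof (intro lcs_semigroup.intro lcs_semigroup_axioms.intro)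
    show "separated_lcs scl \<tau>"
      by unfold_locales
    fix x
    have "continuous_map (top_of_set {0..}) \<tau> (\<lambda>t. T t x)"
      using assms(2) by (simp add: SCLE_semigroup_def)
    then have "limitin \<tau> (\<lambda>t. T t x) (T 0 x) (atin (top_of_set {0..}) 0)"
      by (auto simp: continuous_map_atin)
    then have "limitin \<tau> (\<lambda>t. T t x) (T 0 x) (at 0 within {0..})"
      by (simp add: atin_subtopology_within atin_within_euclidean)
    moreover have "at_right 0 \<le> at (0::real) within {0..}"
      by (intro at_le) auto
    ultimately have "limitin \<tau> (\<lambda>t. T t x) (T 0 x) (at_right 0)"
      unfolding limitin_def by (auto intro: filter_leD)
    then show "limitin \<tau> (\<lambda>t. T t x) x (at_right 0)"
      using assms(2) by (simp add: SCLE_semigroup_def)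
  qed (use assms(2) in \<open>auto simp: SCLE_semigroup_def fun_eq_iff\<close>)
qed

theorem proposition5p4:
  fixes scl :: "complex \<Rightarrow> 'a::ab_group_add \<Rightarrow> 'a"
    and \<tau> :: "'a topology"
    and nrm :: "'a \<Rightarrow> real"
    and T :: "real \<Rightarrow> 'a \<Rightarrow> 'a"
    and A :: "'a \<Rightarrow> 'a"
    and D :: "'a set"
  assumes "condition_C scl \<tau> nrm"
    and "SCLE_semigroup scl \<tau> T"
    and "A = generator scl \<tau> T"
    and "D = generator_dom scl \<tau> T"
  shows
    "(\<forall>z. (\<forall>x. \<exists>I. has_improper_riemann_integral scl \<tau> (laplace_integrand scl T z x) I) \<longrightarrow>
       z \<in> resolvent_set scl D A \<and>
       (\<forall>x. resolvent scl D A z x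
              = improper_riemann_integral scl \<tau> (laplace_integrand scl T z x))) \<and>
     (\<forall>M \<omega>. M \<ge> 1 \<and> of_type scl \<tau> nrm T M \<omega> \<longrightarrow>
       (\<forall>z. Re z > \<omega> \<longrightarrow>
          (\<forall>x. \<exists>I. has_improper_riemann_integral scl \<tau> (laplace_integrand scl T z x) I) \<and>
          z \<in> resolvent_set scl D A)) \<and>
     (\<forall>z. ereal (Re z) > growth_bound scl \<tau> nrm T \<longrightarrow> z \<in> resolvent_set scl D A)"
proof -
  interpret lcs_semigroup scl \<tau> T
    by (rule condition_C_lcs_semigroup[OF assms(1,2)])
  have C: "is_norm scl nrm" "sequentially_complete \<tau>"
    "\<And>U. openin \<tau> U \<Longrightarrow> openin (norm_topology nrm) U"
    using assms(1) by (auto simp: condition_C_def)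
  have a: "z \<in> resolvent_set scl D A"
      "resolvent scl D A z x = improper_riemann_integral scl \<tau> (laplace_integrand scl T z x)"
    if "\<forall>x. \<exists>I. has_improper_riemann_integral scl \<tau> (laplace_integrand scl T z x) I" for z x
    unfolding assms(3,4) using that by (auto intro: laplace_transform_resolvent)
  have b: "\<exists>I. has_improper_riemann_integral scl \<tau> (laplace_integrand scl T z x) I"
    if "M \<ge> 1" "of_type scl \<tau> nrm T M \<omega>" "Re z > \<omega>" for M \<omega> z x
    using that cont_seminorm_le_norm[OF lcs C(1,3)]
    by (intro laplace_integral_exists[OF C(2) that(3,1,2)])
  \<comment> \<open>Lying strictly above the infimum in \<open>ereal\<close> yields an admissible
    \<omega> below \<open>Re z\<close>, also when the growth bound is -\<infinity>.\<close>
  have c: "z \<in> resolvent_set scl D A" if z: "ereal (Re z) > growth_bound scl \<tau> nrm T" for z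
  proof -
    obtain M \<omega> where "M \<ge> 1" "of_type scl \<tau> nrm T M \<omega>" "Re z > \<omega>"
      using z by (auto simp: growth_bound_def INF_less_iff)
    then show ?thesis
      using a(1) b by blast
  qed
  show ?thesis
    using a b c by blast
qed

end
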